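(* Let $n,m\in\mathbb{N}$ and $\alpha>0$, and let $K^{\mathcal{F}_{\alpha,m}}$ be the reproducing kernel of $\mathcal{F}_{\alpha,m}$. For every $z,w\in\mathbb{C}^n$, $$K_z^{\mathcal{F}_{\alpha,m}}(w)=\sum_{k\in J_{n,m}}\;\prod_{r=1}^n e^{\alpha w_r\overline{z_r}}\,L_{k_r}(\alpha|w_r-z_r|^2).$$ Equivalently, $$K_z^{\mathcal{F}_{\alpha,m}}(w)=\sum_{k\in J_{n,m}}\;\prod_{r=1}^n e^{\frac{\alpha}{2}(|w_r|^2+|z_r|^2)+i\alpha\operatorname{Im}(w_r\overline{z_r})}\,\ell_{k_r}(\alpha|w_r-z_r|^2).$$
   Context: Notation: $\mathbb{N}=\{1,2,\ldots\}$, $\mathbb{N}_0=\{0,1,2,\ldots\}$; $|k|=k_1+\cdots+k_n$ for $k\in\mathbb{N}_0^n$; $J_{n,m}=\{k\in\mathbb{N}_0^n\colon|k|\le m-1\}$; $|z|$ is the Euclidean norm on $\mathbb{C}^n$; $\mu_{2n}$ is Lebesgue measure on $\mathbb{C}^n$. $L_j=L_j^{(0)}$ is the Laguerre polynomial of degree $j$, and $\ell_j(t)=e^{-t/2}L_j(t)$ is the Laguerre function. A smooth function $f\colon\mathbb{C}^n\to\mathbb{C}$ is $m$-analytic if $\overline{D}^k f=0$ for every $k\in\mathbb{N}_0^n$ with $|k|=m$, where $\overline{D}^k=\partial_{\overline{z}_1}^{k_1}\cdots\partial_{\overline{z}_n}^{k_n}$ (Wirtinger derivatives). $\mathcal{F}_{\alpha,m}$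 is the space of all $m$-analytic functions $f\colon\mathbb{C}^n\to\mathbb{C}$ with $\|f\|^2_{\mathcal{F}_{\alpha,m}}=\frac{\alpha^n}{\pi^n}\int_{\mathbb{C}^n}|f(z)|^2e^{-\alpha|z|^2}\,d\mu_{2n}(z)<\infty$, a reproducing kernel Hilbert space; its kernel is characterized by $K_z^{\mathcal{F}_{\alpha,m}}\in\mathcal{F}_{\alpha,m}$ and $f(z)=\langle f,K_z^{\mathcal{F}_{\alpha,m}}\rangle$ for all $f\in\mathcal{F}_{\alpha,m}$, $z\in\mathbb{C}^n$ (inner products linear in the first argument). *)

theory Defs
  imports "HOL-Analysis.Analysis"
begin

text \<open>
  Throughout, \<open>\<complex>\<^sup>n\<close> is the type \<open>complex ^ 'n\<close> with \<open>n = CARD('n)\<close>, and multi-indices in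
  \<open>\<nat>\<^sub>0\<^sup>n\<close> are functions \<open>'n \<Rightarrow> nat\<close>.  The norm of this type is the Euclidean norm, and
  \<open>lborel\<close> on it is Lebesgue measure on \<open>\<complex>\<^sup>n = \<real>\<^sup>2\<^sup>n\<close>.
\<close>

section \<open>Smoothness and Wirtinger derivatives\<close>

text \<open>Differentiability is real (Frechet) differentiability; every \<open>frechet_derivative f (at z)\<close>
  below is an \<open>\<real>\<close>-linear map.\<close>

primrec C_k :: "nat \<Rightarrow> ('a::real_normed_vector \<Rightarrow> 'b::real_normed_vector) \<Rightarrow> bool" where
  "C_k 0 f \<longleftrightarrow> continuous_on UNIV f"
| "C_k (Suc k) f \<longleftrightarrow>
     f differentiable_on UNIV \<and> (\<forall>v. C_k k (\<lambda>z. frechet_derivative f (at z) v))"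

definition smooth :: "('a::real_normed_vector \<Rightarrow> 'b::real_normed_vector) \<Rightarrow> bool" where
  "smooth f \<longleftrightarrow> (\<forall>k. C_k k f)"

text \<open>\<open>\<partial>/\<partial>z\<^sub>j\<close>-bar \<open>= (\<partial>/\<partial>x\<^sub>j + \<i> \<partial>/\<partial>y\<^sub>j) / 2\<close>, where \<open>z\<^sub>j = x\<^sub>j + \<i> y\<^sub>j\<close>.\<close>

definition dbar :: "'n::finite \<Rightarrow> (complex ^ 'n \<Rightarrow> complex) \<Rightarrow> complex ^ 'n \<Rightarrow> complex" where
  "dbar j f = (\<lambda>z. (frechet_derivative f (at z) (axis j 1)
                     + \<i> * frechet_derivative f (at z) (axis j \<i>)) / 2)"

text \<open>The index type carries no order, so the composition
  \<open>dbar j\<^sub>1 ^^ k j\<^sub>1 \<circ> \<dots> \<circ> dbar j\<^sub>n ^^ k j\<^sub>n\<close> is taken along some fixed enumeration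
  \<open>[j\<^sub>1, \<dots>, j\<^sub>n]\<close> of \<open>'n\<close>.  On smooth functions the operators \<open>dbar j\<close> commute, so the
  choice does not matter there.\<close>

definition dbar_multi ::
    "('n::finite \<Rightarrow> nat) \<Rightarrow> (complex ^ 'n \<Rightarrow> complex) \<Rightarrow> complex ^ 'n \<Rightarrow> complex" where
  "dbar_multi k = foldr (\<lambda>j. dbar j ^^ k j) (SOME js. distinct js \<and> set js = UNIV)"

definition m_analytic :: "nat \<Rightarrow> (complex ^ 'n::finite \<Rightarrow> complex) \<Rightarrow> bool" where
  "m_analytic m f \<longleftrightarrow>
     smooth f \<and> (\<forall>k :: 'n \<Rightarrow> nat. (\<Sum>j\<in>UNIV. k j) = m \<longrightarrow> (\<forall>z. dbar_multi k f z = 0))"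

section \<open>The polyanalytic Bargmann--Segal--Fock space and its kernel\<close>

definition Fock :: "real \<Rightarrow> nat \<Rightarrow> (complex ^ 'n::finite \<Rightarrow> complex) set" where
  "Fock \<alpha> m =
     {f. m_analytic m f \<and> integrable lborel (\<lambda>z. (cmod (f z))\<^sup>2 * exp (- \<alpha> * (norm z)\<^sup>2))}"

definition Fock_inner ::
    "real \<Rightarrow> (complex ^ 'n::finite \<Rightarrow> complex) \<Rightarrow> (complex ^ 'n \<Rightarrow> complex) \<Rightarrow> complex" where
  "Fock_inner \<alpha> f g =
     of_real (\<alpha> ^ CARD('n) / pi ^ CARD('n)) *
       (LINT z|lborel. f z * cnj (g z) * of_real (exp (- \<alpha> * (norm z)\<^sup>2)))"

definition Fock_kernel ::
    "real \<Rightarrow> nat \<Rightarrow> complex ^ 'n::finite \<Rightarrow> complex ^ 'n \<Rightarrow> complex" where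
  "Fock_kernel \<alpha> m z =
     (THE K. K \<in> Fock \<alpha> m \<and> (\<forall>f\<in>Fock \<alpha> m. f z = Fock_inner \<alpha> f K))"

section \<open>Laguerre polynomials and functions\<close>

definition laguerre_poly :: "nat \<Rightarrow> real \<Rightarrow> real" where
  "laguerre_poly j t = (\<Sum>i\<le>j. (-1) ^ i * real (j choose i) / fact i * t ^ i)"

definition laguerre_fun :: "nat \<Rightarrow> real \<Rightarrow> real" where
  "laguerre_fun j t = exp (- t / 2) * laguerre_poly j t"

definition J :: "nat \<Rightarrow> ('n::finite \<Rightarrow> nat) set" where
  "J m = {k. (\<Sum>j\<in>UNIV. k j) \<le> m - 1}"

end

theory Submission
  imports Defs "HOL-Complex_Analysis.Complex_Analysis" "HOL-Probability.Distributions"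
begin

text \<open>
  The sum of products of Laguerre polynomials in the single variables depends only on the sum of
  the variables: by the generating function it is the generalized Laguerre polynomial
  \<open>L\<close> of parameter \<open>n\<close> and degree \<open>m - 1\<close>.  So the claimed kernel is
  \<open>exp (\<alpha> \<langle>w, z\<rangle>) L (\<alpha> |w - z|\<^sup>2)\<close>.

  To see that it reproduces \<open>f z\<close>, translate by \<open>z\<close>: with
  \<open>F u = f (z + u) exp (- \<alpha> \<langle>u, z\<rangle>)\<close>, the claim is that integrating \<open>F u L (\<alpha> |u|\<^sup>2)\<close>
  against the Gaussian weight gives \<open>(\<pi> / \<alpha>)\<^sup>n F 0\<close>.  Since weight and
  \<open>L (\<alpha> |u|\<^sup>2)\<close> are invariant under \<open>u \<mapsto> e\<^sup>i\<^sup>t u\<close>, we may replace \<open>F\<close> by its average over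
  these rotations.  On the complex line through \<open>u\<close> an \<open>m\<close>-analytic function is a polynomial of
  degree less than \<open>m\<close> in the conjugate variable with entire coefficients, so by Cauchy's formula
  the average is a sum of terms \<open>c\<^sub>j\<close> with \<open>j < m\<close>, homogeneous of degree \<open>2 j\<close> under positive
  dilations, with \<open>c\<^sub>0 = F 0\<close>.  The radial moments of a homogeneous function are explicit
  multiples of its Gaussian integral, and by Vandermonde's identity the integral of \<open>c\<^sub>j\<close>
  against \<open>L\<close> vanishes for \<open>0 < j < m\<close>.
\<close>

section \<open>Laguerre polynomials\<close>

text \<open>The parameter comes first and the degree second. Only natural parameters occur, so
  binomial coefficients suffice.\<close>

definition gen_laguerre :: "nat \<Rightarrow> nat \<Rightarrow> real \<Rightarrow> real" where
  "gen_laguerre a p t = (\<Sum>i\<le>p. (-1) ^ i * real ((p + a) choose (p - i)) / fact i * t ^ i)"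

lemma gen_laguerre_0: "gen_laguerre 0 p = laguerre_poly p"
  by (rule ext, unfold gen_laguerre_def laguerre_poly_def, rule sum.cong)
     (auto simp: binomial_symmetric[symmetric])

text \<open>The generating function exp (- t X / (1 - X)) / (1 - X)^N. It is indexed by the exponent
  N, so that products add both N and t; the Laguerre parameter it belongs to is N - 1.\<close>

definition laguerre_fps :: "nat \<Rightarrow> real \<Rightarrow> real fps" where
  "laguerre_fps N t =
     (fps_exp (- t) oo (fps_X * inverse (1 - fps_X))) * inverse (1 - fps_X) ^ N"

lemma laguerre_fps_mult:
  "laguerre_fps M s * laguerre_fps N t = laguerre_fps (M + N) (s + t)"
proof -
  have "fps_exp (- (s + t)) = fps_exp (- s) * fps_exp (- t)"
    by (simp flip: fps_exp_add_mult)
  then show ?thesis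
    by (simp add: laguerre_fps_def fps_compose_mult_distrib power_add mult_ac)
qed

lemma laguerre_fps_prod:
  "finite A \<Longrightarrow> (\<Prod>r\<in>A. laguerre_fps 1 (t r)) = laguerre_fps (card A) (\<Sum>r\<in>A. t r)"
proof (induction A rule: finite_induct)
  case empty
  show ?case by (simp add: laguerre_fps_def)
next
  case (insert r A)
  then show ?case by (simp add: laguerre_fps_mult)
qed

lemma inverse_one_minus_X_power_nth:
  "(inverse (1 - fps_X) ^ Suc N) $ q = (real ((q + N) choose q))"
proof -
  have "inverse (1 - fps_X) ^ Suc N = inverse ((1 - fps_const 1 * fps_X :: real fps) ^ Suc N)"
    by (simp add: fps_inverse_power fps_inverse_mult)
  then show ?thesis
    by (subst (asm) one_minus_const_fps_X_neg_power') (simp_all add: add.commute)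
qed

text \<open>Expanding the exponential, the i-th term is (- t)^i / i! times X^i / (1 - X)^(i + a +
  1), and the negative binomial series gives its coefficient at X^p.\<close>

lemma laguerre_fps_nth: "laguerre_fps (Suc a) t $ p = gen_laguerre a p t"
proof -
  define Y :: "real fps" where "Y = inverse (1 - fps_X)"
  have Yi: "(fps_X * Y) ^ i * Y ^ Suc a = fps_X ^ i * Y ^ Suc (i + a)" for i
    by (simp add: power_mult_distrib power_add mult_ac)
  have co: "((fps_X * Y) ^ i * Y ^ Suc a) $ p = (if i \<le> p then real ((p + a) choose (p - i)) else 0)" for i
    unfolding Yi unfolding Y_def by (simp add: fps_X_power_mult_nth inverse_one_minus_X_power_nth del: power_Suc)
  have z: "((fps_X * Y) ^ i) $ q = 0" if "q < i" for i q
    using that by (simp add: power_mult_distrib fps_X_power_mult_nth)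
  have "laguerre_fps (Suc a) t $ p
      = (\<Sum>q=0..p. (\<Sum>i=0..q. fps_exp (- t) $ i * (((fps_X * Y) ^ i) $ q)) * (Y ^ Suc a) $ (p - q))"
    by (simp add: laguerre_fps_def fps_mult_nth fps_compose_nth Y_def del: power_Suc)
  \<comment> \<open>The terms with \<open>i > q\<close> vanish by \<open>z\<close>; including them
    makes the range of i independent of q, so the two sums can be swapped.\<close>
  also have "\<dots> = (\<Sum>q=0..p. (\<Sum>i=0..p. fps_exp (- t) $ i * (((fps_X * Y) ^ i) $ q)) * (Y ^ Suc a) $ (p - q))"
    by (intro sum.cong refl arg_cong2[where f=times] sum.mono_neutral_left) (auto simp: z)
  also have "\<dots> = (\<Sum>i=0..p. (fps_exp (- t) $ i) * (((fps_X * Y) ^ i * Y ^ Suc a) $ p))"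
    unfolding fps_mult_nth sum_distrib_right sum_distrib_left
    by (subst sum.swap) (simp add: mult_ac)
  also have "\<dots> = (\<Sum>i=0..p. fps_exp (- t) $ i * real ((p + a) choose (p - i)))"
    by (intro sum.cong) (auto simp: co simp del: power_Suc)
  also have "\<dots> = gen_laguerre a p t"
    unfolding gen_laguerre_def atMost_atLeast0
    by (intro sum.cong) (auto simp: field_simps power_minus[of t] simp del: power_Suc)
  finally show ?thesis .
qed

section \<open>Sums over multi-indices of bounded total degree\<close>

text \<open>A version of \<open>J\<close> relative to a set A of coordinates, for induction on A.
  Entries outside A are fixed to 0 to keep the set finite, and the bound is M itself, so
  \<open>J m\<close> corresponds to \<open>M = m - 1\<close>.\<close>

definition J_on :: "'n set \<Rightarrow> nat \<Rightarrow> ('n \<Rightarrow> nat) set" where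
  "J_on A M = {k. (\<forall>r. r \<notin> A \<longrightarrow> k r = 0) \<and> (\<Sum>r\<in>A. k r) \<le> M}"

lemma finite_J_on:
  assumes "finite A" shows "finite (J_on A M)"
proof -
  have "J_on A M \<subseteq> {k. (\<forall>r\<in>A. k r \<in> {..M}) \<and> (\<forall>r. r \<notin> A \<longrightarrow> k r = 0)}"
    unfolding J_on_def using assms by (auto intro: order_trans[OF member_le_sum])
  moreover have "finite {k. (\<forall>r\<in>A. k r \<in> {..M}) \<and> (\<forall>r. r \<notin> A \<longrightarrow> k r = 0)}"
    using finite_set_of_finite_funs[OF assms, of "{..M}" 0]
    by (rule back_subst) (auto intro!: arg_cong[where f=finite])
  ultimately show ?thesis by (rule finite_subset)
qed

text \<open>A coefficient of the product collects the multi-indices of one total degree; the factor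
  1 / (1 - X) turns coefficients into partial sums, hence degree exactly M into degree at most
  M.\<close>

lemma sum_J_on_prod_nth:
  fixes F :: "'n \<Rightarrow> real fps"
  assumes "finite A"
  shows "(\<Sum>k\<in>J_on A M. \<Prod>r\<in>A. F r $ k r) = ((\<Prod>r\<in>A. F r) * inverse (1 - fps_X)) $ M"
  using assms
proof (induction A arbitrary: M rule: finite_induct)
  case empty
  have "J_on {} M = {\<lambda>_::'n. 0}" by (auto simp: J_on_def)
  then show ?case
    using inverse_one_minus_X_power_nth[of 0 M] by simp
next
  case (insert r A)
  \<comment> \<open>A multi-index on \<open>insert r A\<close> is split into its entry i at r and
    the rest on A, for which total degree \<open>M - i\<close> remains.\<close>
  define T where "T = (SIGMA i:{0..M}. J_on A (M - i))"
  have s: "(\<Sum>x\<in>A. if x = r then i else k x) = sum k A" for k :: "'n \<Rightarrow> nat" and i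
    using insert by (intro sum.cong) auto
  have "(\<Sum>k\<in>J_on (insert r A) M. \<Prod>x\<in>insert r A. F x $ k x)
      = (\<Sum>(i, k)\<in>T. F r $ i * (\<Prod>x\<in>A. F x $ k x))"
    unfolding T_def
  proof (rule sum.reindex_bij_witness[where i="\<lambda>(i, k). k(r := i)" and j="\<lambda>k. (k r, k(r := 0))"], goal_cases)
    case (1 k) then show ?case by simp
  next
    case (2 k) then show ?case using insert by (auto simp: J_on_def s)
  next
    case (3 k) then show ?case using insert by (auto simp: J_on_def)
  next
    case (4 k) then show ?case using insert by (auto simp: J_on_def s)
  next
    case (5 k)
    have "(\<Prod>x\<in>A. F x $ (if x = r then 0 else k x)) = (\<Prod>x\<in>A. F x $ k x)"
      using insert by (intro prod.cong) auto
    then show ?case using insert by simp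
  qed
  also have "\<dots> = (\<Sum>i=0..M. F r $ i * (\<Sum>k\<in>J_on A (M - i). \<Prod>x\<in>A. F x $ k x))"
    unfolding T_def sum_distrib_left using insert
    by (subst sum.Sigma[symmetric]) (auto simp: finite_J_on)
  also have "\<dots> = ((\<Prod>x\<in>insert r A. F x) * inverse (1 - fps_X)) $ M"
    using insert by (simp add: insert.IH mult.assoc fps_mult_nth)
  finally show ?case .
qed

text \<open>The n generating functions with exponent 1 multiply to one with exponent n. The factor 1
  / (1 - X) from the truncation raises the exponent to n + 1, that is, the parameter to n.\<close>

lemma sum_J_prod_laguerre:
  fixes t :: "'n::finite \<Rightarrow> real"
  assumes "m \<ge> 1"
  shows "(\<Sum>k\<in>J m. \<Prod>r\<in>UNIV. laguerre_poly (k r) (t r))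
       = gen_laguerre CARD('n) (m - 1) (\<Sum>r\<in>UNIV. t r)"
proof -
  have "J m = J_on (UNIV :: 'n set) (m - 1)" by (simp add: J_def J_on_def)
  moreover have "laguerre_poly j s = laguerre_fps 1 s $ j" for j s
    using laguerre_fps_nth[of 0 s j] by (simp add: gen_laguerre_0)
  ultimately have "(\<Sum>k\<in>J m. \<Prod>r\<in>UNIV. laguerre_poly (k r) (t r))
      = ((\<Prod>r\<in>UNIV. laguerre_fps 1 (t r)) * inverse (1 - fps_X)) $ (m - 1)"
    by (simp add: sum_J_on_prod_nth)
  also have "\<dots> = laguerre_fps (Suc CARD('n)) (\<Sum>r\<in>UNIV. t r) $ (m - 1)"
    by (simp only: laguerre_fps_prod[OF finite]) (simp add: laguerre_fps_def mult_ac)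
  finally show ?thesis by (simp add: laguerre_fps_nth)
qed

no_notation fps_nth (infixl "$" 75)

section \<open>Smooth functions\<close>

lemma frechet_derivativeI: "(f has_derivative f') (at z) \<Longrightarrow> frechet_derivative f (at z) v = f' v"
  by (metis frechet_derivative_at)

lemma C_k_SucD: "C_k (Suc k) f \<Longrightarrow> C_k k f"
  by (induction k arbitrary: f) (auto intro: differentiable_imp_continuous_on)

lemma C_k_const: "C_k k (\<lambda>_. c)"
  by (induction k arbitrary: c) (auto simp: differentiable_on_def)

lemma C_k_SucI:
  assumes "\<And>z. (f has_derivative f' z) (at z)" "\<And>v. C_k k (\<lambda>z. f' z v)"
  shows "C_k (Suc k) f"
proof -
  have "(\<lambda>z. frechet_derivative f (at z) v) = (\<lambda>z. f' z v)" for v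
    using assms(1) by (auto simp: frechet_derivativeI)
  then show ?thesis
    using assms by (auto simp: differentiable_on_def differentiable_def)
qed

lemma C_k_Suc_has_derivative:
  "C_k (Suc k) f \<Longrightarrow> (f has_derivative frechet_derivative f (at z)) (at z)"
  by (simp add: differentiable_on_def frechet_derivative_works)

lemma C_k_add: "C_k k f \<Longrightarrow> C_k k g \<Longrightarrow> C_k k (\<lambda>z. f z + g z)"
proof (induction k arbitrary: f g)
  case 0 then show ?case by (auto intro: continuous_intros)
next
  case (Suc k)
  show ?case
    by (rule C_k_SucI, rule has_derivative_add[OF Suc.prems[THEN C_k_Suc_has_derivative]])
      (use Suc in auto)
qed

lemma C_k_mult:
  fixes f g :: "_ \<Rightarrow> 'b::real_normed_algebra"
  shows "C_k k f \<Longrightarrow> C_k k g \<Longrightarrow> C_k k (\<lambda>z. f z * g z)"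
proof (induction k arbitrary: f g)
  case 0 then show ?case by (auto intro: continuous_intros)
next
  case (Suc k)
  show ?case
    by (rule C_k_SucI, rule has_derivative_mult[OF Suc.prems[THEN C_k_Suc_has_derivative]])
      (intro C_k_add Suc.IH Suc.prems[THEN C_k_SucD], use Suc.prems in auto)
qed

lemma C_k_bounded_linear: "bounded_linear L \<Longrightarrow> C_k k L"
proof (cases k)
  case 0
  then show "bounded_linear L \<Longrightarrow> C_k k L" by (simp add: linear_continuous_on)
next
  case (Suc l)
  show "bounded_linear L \<Longrightarrow> C_k k L" unfolding Suc
    by (rule C_k_SucI[OF bounded_linear.has_derivative[OF _ has_derivative_ident]])
      (auto simp: C_k_const)
qed

text \<open>The derivative \<open>exp (f z) * frechet_derivative f (at z) v\<close> contains the
  same exponential, so induction on the order closes up with the product rule.\<close>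

lemma C_k_exp:
  fixes f :: "_ \<Rightarrow> complex"
  shows "(\<And>k. C_k k f) \<Longrightarrow> C_k k (\<lambda>z. exp (f z))"
proof (induction k)
  case 0
  from 0[of 0] show ?case by (auto intro: continuous_intros)
next
  case (Suc k)
  have d: "(f has_derivative frechet_derivative f (at z)) (at z)" for z
    by (rule C_k_Suc_has_derivative[OF Suc.prems])
  show ?case
  proof (rule C_k_SucI)
    show "((\<lambda>z. exp (f z)) has_derivative (\<lambda>v. exp (f z) * frechet_derivative f (at z) v)) (at z)" for z
      by (rule has_derivative_compose[OF d DERIV_exp[unfolded has_field_derivative_def]])
    show "C_k k (\<lambda>z. exp (f z) * frechet_derivative f (at z) v)" for v
      using Suc.prems[of "Suc k"] by (intro C_k_mult Suc.IH Suc.prems) auto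
  qed
qed

lemma smooth_const: "smooth (\<lambda>_. c)"
  by (simp add: smooth_def C_k_const)

lemma smooth_add: "smooth f \<Longrightarrow> smooth g \<Longrightarrow> smooth (\<lambda>z. f z + g z)"
  by (simp add: smooth_def C_k_add)

lemma smooth_mult:
  fixes f g :: "_ \<Rightarrow> 'b::real_normed_algebra"
  shows "smooth f \<Longrightarrow> smooth g \<Longrightarrow> smooth (\<lambda>z. f z * g z)"
  by (simp add: smooth_def C_k_mult)

lemma smooth_bounded_linear: "bounded_linear L \<Longrightarrow> smooth L"
  by (simp add: smooth_def C_k_bounded_linear)

lemma smooth_exp:
  fixes f :: "_ \<Rightarrow> complex"
  shows "smooth f \<Longrightarrow> smooth (\<lambda>z. exp (f z))"
  by (simp add: smooth_def C_k_exp)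

lemma smooth_has_derivative:
  "smooth f \<Longrightarrow> (f has_derivative frechet_derivative f (at z)) (at z)"
  unfolding smooth_def using C_k_Suc_has_derivative by blast

lemma smooth_continuous_on: "smooth f \<Longrightarrow> continuous_on UNIV f"
  unfolding smooth_def using C_k.simps(1) by blast

lemma smooth_frechet_derivative: "smooth f \<Longrightarrow> smooth (\<lambda>z. frechet_derivative f (at z) v)"
  unfolding smooth_def using C_k.simps(2) by blast

lemma smooth_line_derivative:
  assumes "smooth f"
  shows "((\<lambda>t. f (z + t *\<^sub>R v)) has_vector_derivative frechet_derivative f (at (z + s *\<^sub>R v)) v) (at s within S)"
proof -
  define f' where "f' = frechet_derivative f (at (z + s *\<^sub>R v))"
  have f': "(f has_derivative f') (at (z + s *\<^sub>R v))"
    unfolding f'_def by (rule smooth_has_derivative[OF assms])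
  have "((\<lambda>t. z + t *\<^sub>R v) has_derivative (\<lambda>t. t *\<^sub>R v)) (at s within S)"
    by (auto intro!: derivative_eq_intros)
  from has_derivative_compose[OF this f']
  show ?thesis
    using linear_scale[OF has_derivative_linear[OF f']]
    by (simp add: has_vector_derivative_def f'_def)
qed

text \<open>Symmetry of second derivatives. The increment of f along v is the integral of its
  v-derivative; differentiating this in direction u under the integral sign, and then in t at 0,
  gives both mixed derivatives.\<close>

lemma frechet_derivative_commute:
  fixes f :: "'a::real_normed_vector \<Rightarrow> 'b::banach"
  assumes "smooth f"
  shows "frechet_derivative (\<lambda>z. frechet_derivative f (at z) v) (at z) u
       = frechet_derivative (\<lambda>z. frechet_derivative f (at z) u) (at z) v"
proof -
  define fv where "fv = (\<lambda>z. frechet_derivative f (at z) v)"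
  define fu where "fu = (\<lambda>z. frechet_derivative f (at z) u)"
  define fvu where "fvu = (\<lambda>z. frechet_derivative fv (at z) u)"
  have sm: "smooth fv" "smooth fu" "smooth fvu"
    using assms by (simp_all add: fv_def fu_def fvu_def smooth_frechet_derivative)
  have cont: "continuous_on S (\<lambda>x. h (k x))" if "smooth h" "continuous_on S k"
    for S :: "'c::topological_space set" and h :: "'a \<Rightarrow> 'b" and k
    using smooth_continuous_on[OF that(1)] that(2) continuous_on_compose2 by blast
  have 1: "f (z + t *\<^sub>R v + s *\<^sub>R u) = f (z + s *\<^sub>R u) + integral {0..t} (\<lambda>\<tau>. fv (z + s *\<^sub>R u + \<tau> *\<^sub>R v))"
    if "0 \<le> t" for s t
  proof -
    have "((\<lambda>\<tau>. fv (z + s *\<^sub>R u + \<tau> *\<^sub>R v)) has_integral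
        f (z + s *\<^sub>R u + t *\<^sub>R v) - f (z + s *\<^sub>R u + 0 *\<^sub>R v)) {0..t}"
      by (rule fundamental_theorem_of_calculus[OF that])
        (use smooth_line_derivative[OF assms, of "z + s *\<^sub>R u" v] in \<open>auto simp: fv_def\<close>)
    from integral_unique[OF this] show ?thesis by (simp add: algebra_simps)
  qed
  have 2: "fu (z + t *\<^sub>R v) = fu z + integral {0..t} (\<lambda>\<tau>. fvu (z + \<tau> *\<^sub>R v))" if t: "0 \<le> t" for t
  proof -
    have "((\<lambda>s. integral (cbox 0 t) (\<lambda>\<tau>. fv (z + s *\<^sub>R u + \<tau> *\<^sub>R v))) has_vector_derivative
        integral (cbox 0 t) (\<lambda>\<tau>. fvu (z + 0 *\<^sub>R u + \<tau> *\<^sub>R v))) (at 0 within UNIV)"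
    proof (rule leibniz_rule_vector_derivative)
      show "((\<lambda>s. fv (z + s *\<^sub>R u + \<tau> *\<^sub>R v)) has_vector_derivative fvu (z + s *\<^sub>R u + \<tau> *\<^sub>R v))
          (at s within UNIV)" for s \<tau> :: real
        using smooth_line_derivative[OF sm(1), of "z + \<tau> *\<^sub>R v" u s UNIV]
        by (simp add: fvu_def add_ac)
      show "(\<lambda>\<tau>. fv (z + s *\<^sub>R u + \<tau> *\<^sub>R v)) integrable_on cbox 0 t" for s
        by (intro integrable_continuous cont sm continuous_intros)
      show "continuous_on (UNIV \<times> cbox 0 t) (\<lambda>(s, \<tau>). fvu (z + s *\<^sub>R u + \<tau> *\<^sub>R v))"
        unfolding case_prod_unfold by (intro cont sm continuous_intros)
    qed auto
    then have "((\<lambda>s. f (z + s *\<^sub>R u) + integral {0..t} (\<lambda>\<tau>. fv (z + s *\<^sub>R u + \<tau> *\<^sub>R v))) has_vector_derivative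
        fu (z + 0 *\<^sub>R u) + integral {0..t} (\<lambda>\<tau>. fvu (z + \<tau> *\<^sub>R v))) (at 0)"
      unfolding fu_def
      by (intro has_vector_derivative_add smooth_line_derivative[OF assms]) simp
    moreover have "((\<lambda>s. f (z + t *\<^sub>R v + s *\<^sub>R u)) has_vector_derivative fu (z + t *\<^sub>R v + 0 *\<^sub>R u)) (at 0)"
      unfolding fu_def by (rule smooth_line_derivative[OF assms])
    ultimately show ?thesis
      using vector_derivative_unique_at by (fastforce simp: 1[OF t])
  qed
  \<comment> \<open>Identity \<open>2\<close> is available for \<open>t \<ge> 0\<close> only, so the
    derivative at 0 is one-sided, within {0..1}, where it is still unique.\<close>
  have "((\<lambda>t. fu z + integral {0..t} (\<lambda>\<tau>. fvu (z + \<tau> *\<^sub>R v))) has_vector_derivative 0 + fvu (z + 0 *\<^sub>R v)) (at 0 within {0..1})"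
    by (intro has_vector_derivative_add integral_has_vector_derivative cont sm continuous_intros) auto
  from has_vector_derivative_transform[OF _ _ this, of "\<lambda>t. fu (z + t *\<^sub>R v)"]
  have "((\<lambda>t. fu (z + t *\<^sub>R v)) has_vector_derivative fvu z) (at 0 within {0..1})"
    by (simp add: 2)
  moreover have "((\<lambda>t. fu (z + t *\<^sub>R v)) has_vector_derivative frechet_derivative fu (at (z + 0 *\<^sub>R v)) v) (at 0 within {0..1})"
    by (rule smooth_line_derivative[OF sm(2)])
  ultimately have "fvu z = frechet_derivative fu (at (z + 0 *\<^sub>R v)) v"
    by (rule vector_derivative_unique_within_closed_interval[of "0::real" 1 0, unfolded box_real, rotated 2]) auto
  then show ?thesis by (simp add: fvu_def fv_def fu_def)
qed

section \<open>Polyanalytic functions\<close>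

lemma dbar_eq: "(f has_derivative f') (at z) \<Longrightarrow> dbar j f z = (f' (axis j 1) + \<i> * f' (axis j \<i>)) / 2"
  by (simp add: dbar_def frechet_derivativeI)

lemma smooth_dbar: "smooth f \<Longrightarrow> smooth (dbar j f)"
  unfolding dbar_def divide_inverse
  by (intro smooth_add smooth_mult smooth_const smooth_frechet_derivative)

lemma frechet_derivative_dbar:
  assumes "smooth f"
  shows "frechet_derivative (dbar j f) (at z) v =
      (frechet_derivative (\<lambda>z. frechet_derivative f (at z) (axis j 1)) (at z) v
       + \<i> * frechet_derivative (\<lambda>z. frechet_derivative f (at z) (axis j \<i>)) (at z) v) / 2"
  unfolding dbar_def
  by (rule frechet_derivativeI)
    (intro bounded_linear.has_derivative[OF bounded_linear_divide] has_derivative_add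
      has_derivative_mult_right smooth_has_derivative smooth_frechet_derivative assms)

lemma dbar_commute: "smooth f \<Longrightarrow> dbar i (dbar j f) = dbar j (dbar i f)"
  by (subst (1 3) dbar_def, rule ext)
    (simp add: frechet_derivative_dbar frechet_derivative_commute[where u="axis i _"]
      add_divide_distrib diff_divide_distrib algebra_simps)

text \<open>m-analyticity in a form suited to induction on m: all m-fold compositions of the
  operators \<open>dbar j\<close> vanish, in whatever order. Equivalence with
  \<open>m_analytic\<close> is \<open>m_analytic_iff_polyanalytic\<close>.\<close>

primrec polyanalytic :: "nat \<Rightarrow> (complex ^ 'n::finite \<Rightarrow> complex) \<Rightarrow> bool" where
  "polyanalytic 0 f \<longleftrightarrow> (\<forall>z. f z = 0)"
| "polyanalytic (Suc m) f \<longleftrightarrow> smooth f \<and> (\<forall>j. polyanalytic m (dbar j f))"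

lemma polyanalytic_smooth: "polyanalytic m f \<Longrightarrow> smooth f"
proof (cases m)
  case 0
  then show "polyanalytic m f \<Longrightarrow> smooth f"
    using smooth_const[of 0] by (metis ext polyanalytic.simps(1))
qed simp

lemma polyanalytic_iff_lists:
  "polyanalytic m f \<longleftrightarrow> smooth f \<and> (\<forall>js. length js = m \<longrightarrow> (\<forall>z. foldr dbar js f z = 0))"
proof (induction m arbitrary: f)
  case 0
  show ?case using polyanalytic_smooth[of 0 f] by auto
next
  case (Suc m)
  have "foldr dbar js (dbar j f) = foldr dbar (js @ [j]) f" for js j by simp
  then have "(\<forall>js. length js = Suc m \<longrightarrow> (\<forall>z. foldr dbar js f z = 0))
     \<longleftrightarrow> (\<forall>j js. length js = m \<longrightarrow> (\<forall>z. foldr dbar js (dbar j f) z = 0))"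
    unfolding length_Suc_conv_rev by (simp del: foldr_append) blast
  then show ?case using Suc.IH smooth_dbar by auto
qed

lemma smooth_foldr_dbar: "smooth f \<Longrightarrow> smooth (foldr dbar js f)"
  by (induction js) (auto simp: smooth_dbar)

text \<open>The operators commute on smooth functions, so any entry of the list can be moved to the
  front.\<close>

lemma foldr_dbar_mset_cong:
  assumes "smooth f" "mset xs = mset ys"
  shows "foldr dbar xs f = foldr dbar ys f"
proof -
  have move: "foldr dbar (as @ x # bs) f = foldr dbar (x # as @ bs) f" for as bs x
  proof (induction as)
    case (Cons a as)
    then show ?case
      using dbar_commute[OF smooth_foldr_dbar[OF assms(1)], of a x "as @ bs"] by simp
  qed simp
  show ?thesis using assms(2)
  proof (induction xs arbitrary: ys)
    case (Cons x xs)
    then have "x \<in> set ys" by (metis list.set_intros(1) mset_eq_setD)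
    then obtain as bs where ys: "ys = as @ x # bs" by (meson split_list)
    with Cons.prems have "mset xs = mset (as @ bs)" by simp
    from Cons.IH[OF this] show ?case unfolding ys move by simp
  qed simp
qed

lemma foldr_dbar_powers:
  "foldr (\<lambda>j. dbar j ^^ k j) xs f = foldr dbar (concat (map (\<lambda>j. replicate (k j) j) xs)) f"
proof (induction xs)
  case (Cons j xs)
  have "foldr dbar (replicate i j) g = (dbar j ^^ i) g" for i g
    by (induction i) auto
  then show ?case using Cons by simp
qed simp

text \<open>A multi-index k corresponds to the list \<open>flat k\<close> in which each j occurs
  \<open>k j\<close> times. Conversely, any list of length m is a permutation of \<open>flat\<close>
  of its own multiplicities.\<close>

lemma m_analytic_iff_polyanalytic: "m_analytic m f \<longleftrightarrow> polyanalytic m f"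
proof (cases "smooth f")
  case True
  define xs :: "'a list" where "xs = (SOME js. distinct js \<and> set js = UNIV)"
  have "distinct xs \<and> set xs = UNIV"
    unfolding xs_def by (rule someI_ex) (metis finite finite_distinct_list)
  then have xs: "distinct xs" "set xs = UNIV" by auto
  define flat where "flat k = concat (map (\<lambda>j. replicate (k j) j) xs)" for k :: "'a \<Rightarrow> nat"
  have dm: "dbar_multi k f = foldr dbar (flat k) f" for k
    unfolding dbar_multi_def xs_def[symmetric] flat_def by (rule foldr_dbar_powers)
  have "length (flat k) = sum k (set xs)" for k
    unfolding flat_def using xs(1) by (simp add: length_concat comp_def sum_list_distinct_conv_sum_set)
  then have len: "length (flat k) = sum k UNIV" for k by (simp add: xs)
  have "count (mset (concat (map (\<lambda>j. replicate (k j) j) ys))) a = (if a \<in> set ys then k a else 0)"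
    if "distinct ys" for ys :: "'a list" and k a
    using that by (induction ys) auto
  then have cnt: "mset (flat (count (mset js))) = mset js" for js
    unfolding flat_def using xs by (intro multiset_eqI) simp
  have "(\<forall>k. sum k UNIV = m \<longrightarrow> (\<forall>z. dbar_multi k f z = 0))
      \<longleftrightarrow> (\<forall>js. length js = m \<longrightarrow> (\<forall>z. foldr dbar js f z = 0))" (is "?L \<longleftrightarrow> ?R")
  proof
    assume L: ?L
    show ?R
    proof (intro allI impI)
      fix js :: "'a list" and z assume "length js = m"
      then have "sum (count (mset js)) UNIV = m"
        by (metis cnt len size_mset)
      with L have "foldr dbar (flat (count (mset js))) f z = 0" unfolding dm by blast
      then show "foldr dbar js f z = 0"
        using foldr_dbar_mset_cong[OF True cnt] by metis
    qed
  next
    assume ?R then show ?L unfolding dm by (simp add: len)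
  qed
  then show ?thesis using True by (simp add: m_analytic_def polyanalytic_iff_lists)
qed (auto simp: m_analytic_def dest: polyanalytic_smooth)

lemma dbar_const: "dbar j (\<lambda>_. c) z = 0"
  by (simp add: dbar_eq[OF has_derivative_const])

lemma dbar_add:
  assumes "smooth f" "smooth g"
  shows "dbar j (\<lambda>z. f z + g z) = (\<lambda>z. dbar j f z + dbar j g z)"
proof
  fix z
  note d = has_derivative_add[OF assms[THEN smooth_has_derivative], of z]
  show "dbar j (\<lambda>z. f z + g z) z = dbar j f z + dbar j g z"
    unfolding dbar_eq[OF d] by (simp add: dbar_def add_divide_distrib algebra_simps)
qed

lemma dbar_mult:
  assumes "smooth f" "smooth g"
  shows "dbar j (\<lambda>z. f z * g z) = (\<lambda>z. f z * dbar j g z + dbar j f z * g z)"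
proof
  fix z
  note d = has_derivative_mult[OF assms[THEN smooth_has_derivative], of z]
  show "dbar j (\<lambda>z. f z * g z) z = f z * dbar j g z + dbar j f z * g z"
    unfolding dbar_eq[OF d] by (simp add: dbar_def add_divide_distrib algebra_simps)
qed

lemma polyanalytic_0: "polyanalytic m (\<lambda>_. 0)"
proof (induction m)
  case (Suc m)
  have "dbar j (\<lambda>_. 0) = (\<lambda>_. 0)" for j :: 'a by (rule ext) (rule dbar_const)
  then show ?case using Suc by (simp add: smooth_const)
qed simp

lemma polyanalytic_Suc: "polyanalytic m f \<Longrightarrow> polyanalytic (Suc m) f"
proof (induction m arbitrary: f)
  case 0
  then have "f = (\<lambda>_. 0)" by auto
  then show ?case using polyanalytic_0 by metis
qed auto

lemma polyanalytic_mono: "polyanalytic m f \<Longrightarrow> m \<le> n \<Longrightarrow> polyanalytic n f"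
  by (rule dec_induct[of m n "\<lambda>n. polyanalytic n f"]) (auto intro: polyanalytic_Suc simp del: polyanalytic.simps)

lemma polyanalytic_add:
  "polyanalytic m f \<Longrightarrow> polyanalytic m g \<Longrightarrow> polyanalytic m (\<lambda>z. f z + g z)"
  by (induction m arbitrary: f g) (auto simp: smooth_add dbar_add)

lemma polyanalytic_sum:
  "(\<And>i. i \<in> A \<Longrightarrow> polyanalytic m (f i)) \<Longrightarrow> polyanalytic m (\<lambda>z. \<Sum>i\<in>A. f i z)"
  by (induction A rule: infinite_finite_induct) (auto simp: polyanalytic_0 polyanalytic_add)

text \<open>Order \<open>Suc p\<close> plays the part of degree at most p in the conjugate
  variables, and degrees add. The proof is the Leibniz rule with induction on p + q.\<close>

lemma polyanalytic_mult:
  "polyanalytic (Suc p) f \<Longrightarrow> polyanalytic (Suc q) g \<Longrightarrow> polyanalytic (Suc (p + q)) (\<lambda>z. f z * g z)"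
proof (induction "p + q" arbitrary: p q f g rule: less_induct)
  case less
  have sm: "smooth f" "smooth g" using less.prems by auto
  \<comment> \<open>For \<open>q = 0\<close> the factor \<open>dbar j g\<close> vanishes; otherwise
    it has degree q - 1 and the induction hypothesis applies.\<close>
  have 1: "polyanalytic (p + q) (\<lambda>z. f z * dbar j g z)" for j
  proof (cases q)
    case 0
    then show ?thesis using less.prems polyanalytic_0[of p] by simp
  next
    case (Suc q')
    then show ?thesis using less.hyps[of p q' f "dbar j g"] less.prems by simp
  qed
  have 2: "polyanalytic (p + q) (\<lambda>z. dbar j f z * g z)" for j
  proof (cases p)
    case 0
    then show ?thesis using less.prems polyanalytic_0[of q] by simp
  next
    case (Suc p')
    then show ?thesis using less.hyps[of p' q "dbar j f" g] less.prems by simp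
  qed
  from 1 2 sm show ?case by (simp add: dbar_mult smooth_mult polyanalytic_add)
qed

lemma polyanalytic_const: "polyanalytic (Suc m) (\<lambda>_. c)"
  by (rule polyanalytic_mono[of 1]) (auto simp: smooth_const dbar_const)

lemma polyanalytic_power:
  assumes "polyanalytic (Suc p) f" shows "polyanalytic (Suc (i * p)) (\<lambda>z. f z ^ i)"
proof (induction i)
  case (Suc i)
  from polyanalytic_mult[OF assms this] show ?case by simp
qed (simp add: polyanalytic_const del: polyanalytic.simps)

lemma bounded_linear_cnj_nth: "bounded_linear (\<lambda>w :: complex ^ 'n::finite. cnj (w $ r))"
  by (rule bounded_linear_compose[OF bounded_linear_cnj bounded_linear_vec_nth])

lemma dbar_nth: "dbar j (\<lambda>w. w $ r) z = 0"
  by (subst dbar_eq[OF bounded_linear.has_derivative[OF bounded_linear_vec_nth has_derivative_ident]])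
    (simp add: axis_def)

lemma dbar_cnj_nth: "dbar j (\<lambda>w. cnj (w $ r)) = (\<lambda>_. if r = j then 1 else 0)"
  by (rule ext, subst dbar_eq[OF bounded_linear.has_derivative[OF bounded_linear_cnj_nth has_derivative_ident]])
    (simp add: axis_def)

lemma polyanalytic_nth: "polyanalytic (Suc 0) (\<lambda>w. w $ r)"
  by (simp add: dbar_nth smooth_bounded_linear bounded_linear_vec_nth)

lemma polyanalytic_cnj_nth: "polyanalytic (Suc (Suc 0)) (\<lambda>w. cnj (w $ r))"
proof -
  have "polyanalytic (Suc 0) (dbar j (\<lambda>w. cnj (w $ r)))" for j
    unfolding dbar_cnj_nth by (rule polyanalytic_const)
  then show ?thesis
    by (subst polyanalytic.simps)
      (simp add: smooth_bounded_linear bounded_linear_cnj_nth del: polyanalytic.simps)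
qed

lemma polyanalytic_exp:
  assumes "polyanalytic (Suc 0) f"
  shows "polyanalytic (Suc 0) (\<lambda>z. exp (f z))"
proof -
  have sm: "smooth f" and d: "\<And>j z. dbar j f z = 0" using assms by auto
  have "dbar j (\<lambda>z. exp (f z)) z = exp (f z) * dbar j f z" for j z
    by (subst dbar_eq[OF has_derivative_compose[OF smooth_has_derivative[OF sm] DERIV_exp[unfolded has_field_derivative_def]]])
      (simp add: dbar_def field_simps)
  then show ?thesis using sm d by (simp add: smooth_exp)
qed

section \<open>Restriction to complex lines\<close>

text \<open>A primitive of \<open>cnj l ^ j\<close> in the conjugate variable, which
  \<open>polyanalytic_slice\<close> uses to integrate a polynomial in \<open>cnj l\<close>.\<close>

lemma has_derivative_cnj_power:
  "((\<lambda>l. cnj l ^ Suc j / of_nat (Suc j)) has_derivative (\<lambda>v. cnj l ^ j * cnj v)) (at l)"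
proof -
  have "((\<lambda>x. x ^ Suc j / of_nat (Suc j)) has_field_derivative x ^ j) (at x)" for x :: complex
    using DERIV_cdivide[OF DERIV_power[OF DERIV_ident, of "Suc j" x UNIV], of "of_nat (Suc j)"]
    by (simp del: of_nat_Suc power_Suc)
  from has_derivative_compose[OF bounded_linear.has_derivative[OF bounded_linear_cnj has_derivative_ident]
      this[unfolded has_field_derivative_def]]
  show ?thesis .
qed

text \<open>The second hypothesis is the Cauchy-Riemann equation; it forces
  \<open>L \<i> = \<i> * L 1\<close>.\<close>

lemma real_linear_complex_linear:
  assumes "linear L" "L 1 + \<i> * L \<i> = (0::complex)"
  shows "L v = L 1 * v"
proof -
  have "\<i> * (L 1 + \<i> * L \<i>) = 0" using assms(2) by simp
  then have i: "L \<i> = \<i> * L 1" by (simp add: distrib_left flip: mult.assoc)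
  have "L v = L (Re v *\<^sub>R 1 + Im v *\<^sub>R \<i>)"
    by (rule arg_cong[where f=L]) (simp add: complex_eq_iff)
  also have "\<dots> = Re v *\<^sub>R L 1 + Im v *\<^sub>R L \<i>"
    using assms(1) by (simp only: linear_add linear_scale)
  also have "\<dots> = L 1 * v"
    unfolding i by (simp add: complex_eq_iff algebra_simps)
  finally show ?thesis .
qed

text \<open>The chain rule for the conjugate derivative along a complex line: with L the derivative
  of f, the left side is twice the conjugate derivative of \<open>f (z + l *s u)\<close> in l. In
  each coordinate the complex linear part of L cancels.\<close>

lemma linear_dbar_sum:
  fixes L :: "complex ^ 'n::finite \<Rightarrow> complex"
  assumes "linear L"
  shows "L u + \<i> * L (\<i> *s u) = (\<Sum>r\<in>UNIV. cnj (u $ r) * (L (axis r 1) + \<i> * L (axis r \<i>)))"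
proof -
  have ax: "L (axis r c) = of_real (Re c) * L (axis r 1) + of_real (Im c) * L (axis r \<i>)" for r c
  proof -
    have "axis r c = Re c *\<^sub>R axis r 1 + Im c *\<^sub>R (axis r \<i> :: complex ^ 'n)"
      by (simp add: vec_eq_iff axis_def complex_eq_iff)
    then show ?thesis
      using assms by (simp only: linear_add linear_scale) (simp add: scaleR_conv_of_real)
  qed
  have exp: "L w = (\<Sum>r\<in>UNIV. L (axis r (w $ r)))" for w
  proof -
    have "w = (\<Sum>r\<in>UNIV. axis r (w $ r))"
      by (simp add: vec_eq_iff axis_def)
    then show ?thesis using linear_sum[OF assms] by metis
  qed
  have "L (axis r (u $ r)) + \<i> * L (axis r (\<i> * u $ r))
      = cnj (u $ r) * (L (axis r 1) + \<i> * L (axis r \<i>))" for r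
    unfolding ax[of r "u $ r"] ax[of r "\<i> * u $ r"]
    by (simp add: complex_eq_iff algebra_simps)
  then show ?thesis
    unfolding exp[of u] exp[of "\<i> *s u"] sum_distrib_left sum.distrib[symmetric] by simp
qed

lemma bounded_linear_scalar_mult_vec: "bounded_linear (\<lambda>l :: complex. l *s u)"
  by (rule linear_conv_bounded_linear[THEN iffD1])
    (auto intro!: linearI simp: vec_eq_iff algebra_simps)

text \<open>Induction on m. The conjugate derivative of the slice is a combination of the functions
  \<open>dbar r f\<close> on the line, hence by induction a polynomial in \<open>cnj l\<close> with
  entire coefficients \<open>H j\<close>. Subtracting its primitive from the slice leaves a function
  G satisfying the Cauchy-Riemann equation.\<close>

lemma polyanalytic_slice:
  fixes f :: "complex ^ 'n::finite \<Rightarrow> complex"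
  assumes "polyanalytic m f"
  shows "\<exists>h. (\<forall>j<m. h j holomorphic_on UNIV) \<and> (\<forall>l. f (z + l *s u) = (\<Sum>j<m. cnj l ^ j * h j l))"
  using assms
proof (induction m arbitrary: f)
  case 0
  then show ?case by simp
next
  case (Suc m)
  have sm: "smooth f" using Suc.prems by simp
  have "\<forall>r. \<exists>h. (\<forall>j<m. h j holomorphic_on UNIV) \<and> (\<forall>l. dbar r f (z + l *s u) = (\<Sum>j<m. cnj l ^ j * h j l))"
    using Suc by simp
  then obtain h where h: "\<And>r j. j < m \<Longrightarrow> h r j holomorphic_on UNIV"
    "\<And>r l. dbar r f (z + l *s u) = (\<Sum>j<m. cnj l ^ j * h r j l)"
    by metis
  define H where "H j l = (\<Sum>r\<in>UNIV. cnj (u $ r) * h r j l)" for j l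
  have H: "H j holomorphic_on UNIV" if "j < m" for j
    unfolding H_def using h(1)[OF that] by (intro holomorphic_intros) auto
  define H' where "H' j = deriv (H j)" for j
  have H': "(H j has_derivative (\<lambda>v. H' j l * v)) (at l)" if "j < m" for j l
    using holomorphic_derivI[OF H[OF that] open_UNIV UNIV_I, of l]
    by (simp add: H'_def has_field_derivative_def)
  have sumH: "(\<Sum>r\<in>UNIV. cnj (u $ r) * dbar r f (z + l *s u)) = (\<Sum>j<m. cnj l ^ j * H j l)" for l
    unfolding h(2) H_def sum_distrib_left by (subst sum.swap) (simp add: mult_ac)
  define G where "G l = f (z + l *s u) - (\<Sum>j<m. cnj l ^ Suc j / of_nat (Suc j) * H j l)" for l
  have "\<exists>D. (G has_field_derivative D) (at l)" for l
  proof -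
    define f' where "f' = frechet_derivative f (at (z + l *s u))"
    have f': "(f has_derivative f') (at (z + l *s u))"
      unfolding f'_def by (rule smooth_has_derivative[OF sm])
    have lf: "linear f'" by (rule has_derivative_linear[OF f'])
    have "((\<lambda>l. z + l *s u) has_derivative (\<lambda>v. v *s u)) (at l)"
      using has_derivative_add[OF has_derivative_const[of z]
          bounded_linear.has_derivative[OF bounded_linear_scalar_mult_vec[of u] has_derivative_ident]]
      by simp
    from has_derivative_compose[OF this f']
    have 1: "((\<lambda>l. f (z + l *s u)) has_derivative (\<lambda>v. f' (v *s u))) (at l)" .
    define L where "L v = f' (v *s u) - (\<Sum>j<m. cnj l ^ Suc j / of_nat (Suc j) * (H' j l * v)
        + cnj l ^ j * cnj v * H j l)" for v
    have GL: "(G has_derivative L) (at l)"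
      unfolding G_def L_def
      by (intro has_derivative_diff 1 has_derivative_sum has_derivative_mult has_derivative_cnj_power H') auto
    \<comment> \<open>The conjugate derivative of one term of the primitive: the part with D, from
      the complex derivative of \<open>H j\<close>, cancels, and only the part from
      \<open>cnj l\<close> remains.\<close>
    have key: "(A * (D * 1) + B * cnj 1 * C) + \<i> * (A * (D * \<i>) + B * cnj \<i> * C) = 2 * (B * C)"
      for A B C D :: complex by (simp add: complex_eq_iff)
    have "L 1 + \<i> * L \<i> = f' (1 *s u) + \<i> * f' (\<i> *s u)
        - ((\<Sum>j<m. cnj l ^ Suc j / of_nat (Suc j) * (H' j l * 1) + cnj l ^ j * cnj 1 * H j l)
         + \<i> * (\<Sum>j<m. cnj l ^ Suc j / of_nat (Suc j) * (H' j l * \<i>) + cnj l ^ j * cnj \<i> * H j l))"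
      unfolding L_def by (simp only: right_diff_distrib) (simp only: algebra_simps)
    also have "\<dots> = f' u + \<i> * f' (\<i> *s u) - 2 * (\<Sum>j<m. cnj l ^ j * H j l)"
      unfolding sum_distrib_left sum.distrib[symmetric] key by simp
    also have "f' u + \<i> * f' (\<i> *s u) = 2 * (\<Sum>r\<in>UNIV. cnj (u $ r) * dbar r f (z + l *s u))"
      unfolding linear_dbar_sum[OF lf] by (simp add: dbar_def f'_def sum_distrib_left)
    finally have "L 1 + \<i> * L \<i> = 0" by (simp add: sumH)
    then have "L = (\<lambda>v. L 1 * v)"
      using real_linear_complex_linear has_derivative_linear[OF GL] by blast
    then have "(G has_field_derivative L 1) (at l)"
      using GL unfolding has_field_derivative_def by metis
    then show ?thesis ..
  qed
  then have G: "G holomorphic_on UNIV"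
    by (auto simp: holomorphic_on_def field_differentiable_def)
  \<comment> \<open>G becomes the coefficient of degree 0, and the primitive moves each
    \<open>H i\<close> up by one degree.\<close>
  define k where "k j = (case j of 0 \<Rightarrow> G | Suc i \<Rightarrow> (\<lambda>l. H i l / of_nat (Suc i)))" for j
  have "k j holomorphic_on UNIV" if "j < Suc m" for j
    using that G H by (cases j) (auto simp: k_def intro!: holomorphic_intros simp del: of_nat_Suc)
  moreover have "f (z + l *s u) = (\<Sum>j<Suc m. cnj l ^ j * k j l)" for l
    unfolding sum.lessThan_Suc_shift by (simp add: k_def G_def del: of_nat_Suc)
  ultimately show ?case by blast
qed

section \<open>Averages over circles\<close>

text \<open>One full turn takes t from 0 to 1, as in \<open>circlepath\<close>, so integrals over
  {0..1} are averages.\<close>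

definition unit_circle :: "real \<Rightarrow> complex" where
  "unit_circle t = exp (2 * of_real pi * \<i> * of_real t)"

lemma norm_unit_circle [simp]: "cmod (unit_circle t) = 1"
  by (simp add: unit_circle_def)

lemma continuous_on_unit_circle: "continuous_on S unit_circle"
  unfolding unit_circle_def by (intro continuous_intros)

text \<open>On the circle of radius \<rho> the conjugate of l is \<rho>^2 / l, so the integrand is
  \<rho>^(2 j) h(l) / l^j, and Cauchy's formula for derivatives yields the j-th Taylor coefficient
  of h.\<close>

lemma circle_average_cnj_power_entire:
  assumes h: "h holomorphic_on UNIV" and "\<rho> > 0"
  shows "((\<lambda>t. cnj (of_real \<rho> * unit_circle t) ^ j * h (of_real \<rho> * unit_circle t))
           has_integral of_real (\<rho> ^ (2 * j)) * ((deriv ^^ j) h 0 / fact j)) {0..1}"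
proof -
  define e where "e = (\<lambda>t. of_real \<rho> * unit_circle t)"
  have nz: "e t \<noteq> 0" for t using \<open>\<rho> > 0\<close> by (simp add: e_def unit_circle_def)
  have cp: "circlepath 0 \<rho> t = e t" for t
    by (simp add: circlepath e_def unit_circle_def)
  have vd: "vector_derivative (circlepath 0 \<rho>) (at t within {0..1}) = 2 * pi * \<i> * e t" if "t \<in> {0..1}" for t
    using that by (simp add: vector_derivative_circlepath01 e_def unit_circle_def)
  have "((\<lambda>u. h u / (u - 0) ^ Suc j) has_contour_integral (2 * pi * \<i>) / fact j * (deriv ^^ j) h 0) (circlepath 0 \<rho>)"
    using h \<open>\<rho> > 0\<close>
    by (intro Cauchy_has_contour_integral_higher_derivative_circlepath)
      (auto intro: holomorphic_on_imp_continuous_on holomorphic_on_subset)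
  then have "((\<lambda>t. h (e t) / e t ^ Suc j * (2 * pi * \<i> * e t)) has_integral (2 * pi * \<i>) / fact j * (deriv ^^ j) h 0) {0..1}"
    unfolding has_contour_integral_def
    by (rule has_integral_eq[rotated]) (simp add: cp vd)
  note * = has_integral_mult_right[OF this, of "of_real (\<rho> ^ (2 * j)) / (2 * pi * \<i>)"]
  have 1: "((\<lambda>t. of_real (\<rho> ^ (2 * j)) / e t ^ j * h (e t)) has_integral of_real (\<rho> ^ (2 * j)) * ((deriv ^^ j) h 0 / fact j)) {0..1}"
    using * nz by (simp add: field_simps)
  have 2: "of_real (\<rho> ^ (2 * j)) / e t ^ j = cnj (e t) ^ j" for t
  proof -
    have "e t * cnj (e t) = of_real (\<rho> ^ 2)"
      by (simp add: complex_norm_square[symmetric] e_def norm_mult del: complex_cnj_mult)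
    then have "e t ^ j * cnj (e t) ^ j = of_real (\<rho> ^ (2 * j))"
      by (simp add: power_mult flip: power_mult_distrib)
    then show ?thesis using nz[of t] by (simp add: field_simps)
  qed
  from 1 show ?thesis unfolding 2 by (simp add: e_def)
qed

text \<open>The number \<open>c j\<close> is the j-th Taylor coefficient of \<open>h j\<close> times
  E, so the same c serves all radii. The entire factor E makes room for the exponential that appears
  when the kernel is translated.\<close>

lemma polyanalytic_circle_average:
  assumes "polyanalytic m f" "E holomorphic_on UNIV" "m > 0"
  shows "\<exists>c. c 0 = f z * E 0 \<and>
     (\<forall>\<rho>>0. ((\<lambda>t. f (z + (of_real \<rho> * unit_circle t) *s u) * E (of_real \<rho> * unit_circle t))
         has_integral (\<Sum>j<m. c j * of_real (\<rho> ^ (2 * j)))) {0..1})"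
proof -
  from polyanalytic_slice[OF assms(1)] obtain h where
    h: "\<And>j. j < m \<Longrightarrow> h j holomorphic_on UNIV" "\<And>l. f (z + l *s u) = (\<Sum>j<m. cnj l ^ j * h j l)"
    by metis
  define c where "c j = (deriv ^^ j) (\<lambda>l. h j l * E l) 0 / fact j" for j
  have "f (z + 0 *s u) = h 0 0"
    unfolding h(2) using assms(3) by (subst sum.remove[of _ 0]) (auto simp: power_0_left)
  then have "c 0 = f z * E 0" by (simp add: c_def)
  moreover have "((\<lambda>t. f (z + (of_real \<rho> * unit_circle t) *s u) * E (of_real \<rho> * unit_circle t))
         has_integral (\<Sum>j<m. c j * of_real (\<rho> ^ (2 * j)))) {0..1}" if "\<rho> > 0" for \<rho>
  proof -
    have "((\<lambda>t. \<Sum>j<m. cnj (of_real \<rho> * unit_circle t) ^ j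
             * (h j (of_real \<rho> * unit_circle t) * E (of_real \<rho> * unit_circle t)))
         has_integral (\<Sum>j<m. of_real (\<rho> ^ (2 * j)) * c j)) {0..1}"
      unfolding c_def
      by (intro has_integral_sum circle_average_cnj_power_entire that holomorphic_intros h(1) assms(2)) auto
    then show ?thesis
      by (simp add: h(2) sum_distrib_right sum_distrib_left mult_ac)
  qed
  ultimately show ?thesis by blast
qed

section \<open>Lebesgue measure and Gaussian weights\<close>

lemma borel_measurable_linear:
  fixes T :: "'a::euclidean_space \<Rightarrow> 'b::euclidean_space"
  shows "linear T \<Longrightarrow> T \<in> borel_measurable borel"
  by (intro borel_measurable_continuous_onI linear_continuous_on) (simp add: linear_conv_bounded_linear)

lemma nn_integral_lborel_translate:
  fixes f :: "'a::euclidean_space \<Rightarrow> ennreal"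
  assumes [measurable]: "f \<in> borel_measurable borel"
  shows "(\<integral>\<^sup>+x. f (c + x) \<partial>lborel) = (\<integral>\<^sup>+x. f x \<partial>lborel)"
  by (subst (2) lborel_distr_plus[of c, symmetric]) (simp add: nn_integral_distr)

text \<open>Uniqueness of translation invariant measures: for \<open>g\<close> the indicator of the unit ball,
  evaluating \<open>\<integral>\<integral> f (T x + y) g y dx dy\<close> in the two possible orders yields
  \<open>\<integral> f (T x) dx \<cdot> \<integral> g = \<integral> f \<cdot> \<integral> g\<close>.\<close>
lemma nn_integral_lborel_orthogonal:
  fixes f :: "'a::euclidean_space \<Rightarrow> ennreal" and T :: "'a \<Rightarrow> 'a"
  assumes T: "orthogonal_transformation T" and f [measurable]: "f \<in> borel_measurable borel"
  shows "(\<integral>\<^sup>+x. f (T x) \<partial>lborel) = (\<integral>\<^sup>+x. f x \<partial>lborel)"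
proof -
  note [measurable] = borel_measurable_linear[OF orthogonal_transformation_linear[OF T]]
  have lin: "linear T" by (rule orthogonal_transformation_linear[OF T])
  define g :: "'a \<Rightarrow> ennreal" where "g = indicator (ball 0 1)"
  have gm [measurable]: "g \<in> borel_measurable borel" unfolding g_def by (rule borel_measurable_indicator) simp
  have g_norm: "g x = g y" if "norm x = norm y" for x y using that by (simp add: g_def indicator_def)
  define V where "V = emeasure lborel (ball (0::'a) 1)"
  have V: "(\<integral>\<^sup>+x. g x \<partial>lborel) = V" by (simp add: g_def V_def)
  have "V \<noteq> 0" "V \<noteq> \<infinity>"
    unfolding V_def using emeasure_bounded_finite[of "ball (0::'a) 1"] open_not_negligible[of "ball (0::'a) 1"]
    by (auto simp: negligible_iff_null_sets null_sets_completionI null_sets_def)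
  have "surj T" by (rule orthogonal_transformation_surj[OF T])
  have "(\<integral>\<^sup>+x. f (T x) \<partial>lborel) * V = (\<integral>\<^sup>+y. (\<integral>\<^sup>+x. f (T x) \<partial>lborel) * g y \<partial>lborel)"
    by (simp add: nn_integral_cmult V)
  also have "\<dots> = (\<integral>\<^sup>+y. \<integral>\<^sup>+x. f (T x + y) * g y \<partial>lborel \<partial>lborel)"
  proof (rule nn_integral_cong)
    fix y
    from \<open>surj T\<close> obtain b where b: "y = T b" by auto
    have "(\<integral>\<^sup>+x. f (T (b + x)) \<partial>lborel) = (\<integral>\<^sup>+x. f (T x) \<partial>lborel)"
      by (rule nn_integral_lborel_translate) measurable
    then show "(\<integral>\<^sup>+x. f (T x) \<partial>lborel) * g y = (\<integral>\<^sup>+x. f (T x + y) * g y \<partial>lborel)"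
      by (simp add: nn_integral_multc b linear_add[OF lin] add.commute)
  qed
  also have "\<dots> = (\<integral>\<^sup>+x. \<integral>\<^sup>+y. f (T x + y) * g y \<partial>lborel \<partial>lborel)"
    by (rule lborel_pair.Fubini') measurable
  also have "\<dots> = (\<integral>\<^sup>+x. \<integral>\<^sup>+y. f y * g (y - T x) \<partial>lborel \<partial>lborel)"
  proof (rule nn_integral_cong)
    fix x
    have "(\<integral>\<^sup>+y. f (T x + y) * g (T x + y - T x) \<partial>lborel) = (\<integral>\<^sup>+y. f y * g (y - T x) \<partial>lborel)"
      by (rule nn_integral_lborel_translate) measurable
    then show "(\<integral>\<^sup>+y. f (T x + y) * g y \<partial>lborel) = (\<integral>\<^sup>+y. f y * g (y - T x) \<partial>lborel)"
      by simp
  qed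
  also have "\<dots> = (\<integral>\<^sup>+y. \<integral>\<^sup>+x. f y * g (y - T x) \<partial>lborel \<partial>lborel)"
    by (rule lborel_pair.Fubini'[symmetric]) measurable
  also have "\<dots> = (\<integral>\<^sup>+y. f y * V \<partial>lborel)"
  proof (rule nn_integral_cong)
    fix y
    from \<open>surj T\<close> obtain b where b: "y = T b" by auto
    \<comment> \<open>Here orthogonality enters: \<open>y = T b\<close> gives y - T x = T (b - x),
      which has the norm of - b + x.\<close>
    have "g (y - T x) = g (- b + x)" for x
      by (rule g_norm) (metis T b lin linear_diff norm_minus_commute orthogonal_transformation_norm uminus_add_conv_diff)
    moreover have "(\<integral>\<^sup>+x. g (- b + x) \<partial>lborel) = V"
      using nn_integral_lborel_translate[OF gm, of "- b"] V by simp
    ultimately show "(\<integral>\<^sup>+x. f y * g (y - T x) \<partial>lborel) = f y * V"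
      by (simp add: nn_integral_cmult)
  qed
  also have "\<dots> = (\<integral>\<^sup>+y. f y \<partial>lborel) * V"
    by (simp add: nn_integral_multc)
  finally show ?thesis
    using \<open>V \<noteq> 0\<close> \<open>V \<noteq> \<infinity>\<close> by (metis ennreal_mult_cancel_left infinity_ennreal_def mult.commute)
qed

lemma lborel_distr_orthogonal:
  fixes T :: "'a::euclidean_space \<Rightarrow> 'a"
  assumes "orthogonal_transformation T"
  shows "distr lborel borel T = lborel"
proof (rule measure_eqI)
  fix A assume "A \<in> sets (distr lborel borel T)"
  then have [measurable]: "A \<in> sets borel" by simp
  note [measurable] = borel_measurable_linear[OF orthogonal_transformation_linear[OF assms]]
  have "emeasure (distr lborel borel T) A = (\<integral>\<^sup>+x. indicator A x \<partial>distr lborel borel T)"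
    by simp
  also have "\<dots> = (\<integral>\<^sup>+x. indicator A (T x) \<partial>lborel)"
    by (rule nn_integral_distr) measurable
  also have "\<dots> = (\<integral>\<^sup>+x. indicator A x \<partial>lborel)"
    by (rule nn_integral_lborel_orthogonal[OF assms]) simp
  also have "\<dots> = emeasure lborel A" by simp
  finally show "emeasure (distr lborel borel T) A = emeasure lborel A" .
qed simp

lemma
  fixes f :: "'a::euclidean_space \<Rightarrow> 'b::{banach, second_countable_topology}" and T :: "'a \<Rightarrow> 'a"
  assumes T: "orthogonal_transformation T" and [measurable]: "f \<in> borel_measurable borel"
  shows integral_lborel_orthogonal: "(LINT x|lborel. f (T x)) = (LINT x|lborel. f x)"
    and integrable_lborel_orthogonal: "integrable lborel (\<lambda>x. f (T x)) \<longleftrightarrow> integrable lborel f"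
proof -
  note [measurable] = borel_measurable_linear[OF orthogonal_transformation_linear[OF T]]
  have eq: "distr lborel borel T = lborel"
    by (rule lborel_distr_orthogonal[OF T])
  show "(LINT x|lborel. f (T x)) = (LINT x|lborel. f x)"
    by (subst (2) eq[symmetric]) (simp add: integral_distr)
  show "integrable lborel (\<lambda>x. f (T x)) \<longleftrightarrow> integrable lborel f"
    by (subst (2) eq[symmetric]) (simp add: integrable_distr_eq)
qed

lemma
  fixes f :: "'a::euclidean_space \<Rightarrow> 'b::{banach, second_countable_topology}"
  assumes [measurable]: "f \<in> borel_measurable borel"
  shows integral_lborel_translate: "(LINT x|lborel. f (c + x)) = (LINT x|lborel. f x)"
    and integrable_lborel_translate: "integrable lborel (\<lambda>x. f (c + x)) \<longleftrightarrow> integrable lborel f"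
  by (subst (2) lborel_distr_plus[of c, symmetric], simp add: integral_distr integrable_distr_eq)+

lemma
  fixes f :: "'a::euclidean_space \<Rightarrow> 'b::{banach, second_countable_topology}"
  assumes c: "c > 0" and [measurable]: "f \<in> borel_measurable borel"
  shows integral_lborel_dilate: "(LINT x|lborel. f x) = c ^ DIM('a) *\<^sub>R (LINT x|lborel. f (c *\<^sub>R x))"
    and integrable_lborel_dilate: "integrable lborel (\<lambda>x. f (c *\<^sub>R x)) \<longleftrightarrow> integrable lborel f"
proof -
  have eq: "lborel = density (distr lborel borel (\<lambda>x::'a. c *\<^sub>R x)) (\<lambda>_. ennreal (c ^ DIM('a)))"
    using lborel_affine[of c "0::'a"] c by simp
  show "(LINT x|lborel. f x) = c ^ DIM('a) *\<^sub>R (LINT x|lborel. f (c *\<^sub>R x))"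
    using c by (subst eq) (simp add: integral_density integral_distr)
  show "integrable lborel (\<lambda>x. f (c *\<^sub>R x)) \<longleftrightarrow> integrable lborel f"
  proof -
    have "integrable lborel f \<longleftrightarrow> integrable lborel (\<lambda>x. c ^ DIM('a) *\<^sub>R f (c *\<^sub>R x))"
      using c by (subst eq) (simp add: integrable_density integrable_distr_eq)
    also have "\<dots> \<longleftrightarrow> integrable lborel (\<lambda>x. f (c *\<^sub>R x))"
      using c integrable_scaleR_right[of "1 / c ^ DIM('a)" lborel "\<lambda>x. c ^ DIM('a) *\<^sub>R f (c *\<^sub>R x)"]
      by auto
    finally show ?thesis ..
  qed
qed

section \<open>Gaussian integrals and radial moments\<close>

text \<open>The integrand is a multiple of the normal density with variance 1 / (2 a).\<close>

lemma nn_integral_gaussian_real: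
  assumes "a > 0"
  shows "(\<integral>\<^sup>+x. exp (- a * x\<^sup>2) \<partial>lborel) = ennreal (sqrt (pi / a))"
proof -
  define \<sigma> where "\<sigma> = sqrt (1 / (2 * a))"
  have \<sigma>: "\<sigma> > 0" "\<sigma>\<^sup>2 = 1 / (2 * a)" using assms by (auto simp: \<sigma>_def)
  have "exp (- a * x\<^sup>2) = sqrt (pi / a) * normal_density 0 \<sigma> x" for x
    using assms by (simp add: normal_density_def \<sigma> real_sqrt_divide)
  then have "(\<integral>\<^sup>+x. exp (- a * x\<^sup>2) \<partial>lborel) = ennreal (sqrt (pi / a)) * (\<integral>\<^sup>+x. normal_density 0 \<sigma> x \<partial>lborel)"
    using assms by (simp add: ennreal_mult' nn_integral_cmult)
  also have "(\<integral>\<^sup>+x. normal_density 0 \<sigma> x \<partial>lborel) = 1"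
    using \<sigma>(1) by (simp add: nn_integral_eq_integral)
  finally show ?thesis by simp
qed

lemma has_bochner_integral_gaussian:
  assumes "a > 0"
  shows "has_bochner_integral lborel (\<lambda>u::'a::euclidean_space. exp (- a * (norm u)\<^sup>2)) (sqrt (pi / a) ^ DIM('a))"
proof (rule has_bochner_integral_nn_integral)
  have "ennreal (exp (- a * (norm u)\<^sup>2)) = (\<Prod>b\<in>Basis. ennreal (exp (- a * (u \<bullet> b)\<^sup>2)))" for u :: 'a
    unfolding power2_norm_eq_inner euclidean_inner[of u u]
    by (simp add: prod_ennreal sum_distrib_left exp_sum power2_eq_square flip: sum_negf)
  then have "(\<integral>\<^sup>+u. exp (- a * (norm (u::'a))\<^sup>2) \<partial>lborel)
      = (\<integral>\<^sup>+u. (\<Prod>b\<in>Basis. ennreal (exp (- a * (u \<bullet> b)\<^sup>2))) \<partial>(lborel :: 'a measure))"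
    by simp
  also have "\<dots> = (\<Prod>b\<in>(Basis :: 'a set). \<integral>\<^sup>+x. ennreal (exp (- a * x\<^sup>2)) \<partial>lborel)"
    by (rule nn_integral_lborel_prod) measurable
  also have "\<dots> = ennreal (sqrt (pi / a) ^ DIM('a))"
    unfolding nn_integral_gaussian_real[OF assms] using assms by (simp add: ennreal_power)
  finally show "(\<integral>\<^sup>+u. exp (- a * (norm (u::'a))\<^sup>2) \<partial>lborel) = ennreal (sqrt (pi / a) ^ DIM('a))" .
qed (use assms in auto)

text \<open>Only even powers of the norm are needed: they are the monomials of a polynomial in
  \<open>a * (norm u)\<^sup>2\<close>.\<close>

definition gauss_weight :: "real \<Rightarrow> nat \<Rightarrow> 'a::real_normed_vector \<Rightarrow> real" where
  "gauss_weight a i u = norm u ^ (2 * i) * exp (- a * (norm u)\<^sup>2)"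

lemma gauss_weight_nonneg [simp]: "0 \<le> gauss_weight a i u"
  by (simp add: gauss_weight_def)

lemma borel_measurable_gauss_weight [measurable]: "gauss_weight a i \<in> borel_measurable borel"
  unfolding gauss_weight_def[abs_def] by (intro borel_measurable_continuous_onI continuous_intros)

lemma gauss_weight_add: "norm u ^ (2 * j) * gauss_weight a i u = gauss_weight a (i + j) u"
  by (simp add: gauss_weight_def distrib_left power_add mult_ac)

lemma power_le_fact_mult_exp:
  assumes "(0::real) \<le> x" shows "x ^ i \<le> fact i * exp x"
proof -
  have "(\<Sum>k\<in>{i}. x ^ k /\<^sub>R fact k) \<le> (\<Sum>k. x ^ k /\<^sub>R fact k)"
    using assms by (intro sum_le_suminf summable_exp_generic) auto
  then show ?thesis by (simp add: exp_def field_simps)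
qed

text \<open>Half of the exponent absorbs the power of the norm, through x^i \<le> i! exp x with x =
  a |u|^2 / 2; the other half is an integrable Gaussian.\<close>

lemma integrable_gauss_weight:
  assumes "a > 0"
  shows "integrable lborel (gauss_weight a i :: 'a::euclidean_space \<Rightarrow> real)"
proof (rule Bochner_Integration.integrable_bound)
  show "integrable lborel (\<lambda>u::'a. fact i / (a / 2) ^ i * exp (- (a / 2) * (norm u)\<^sup>2))"
    using assms by (intro integrable_mult_right has_bochner_integral_gaussian[THEN integrable.intros]) auto
  have "gauss_weight a i u \<le> fact i / (a / 2) ^ i * exp (- (a / 2) * (norm u)\<^sup>2)" for u :: 'a
  proof -
    have "(a / 2 * (norm u)\<^sup>2) ^ i \<le> fact i * exp (a / 2 * (norm u)\<^sup>2)"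
      using assms by (intro power_le_fact_mult_exp) auto
    then have "norm u ^ (2 * i) \<le> fact i / (a / 2) ^ i * exp (a / 2 * (norm u)\<^sup>2)"
      unfolding power_mult using assms by (simp add: field_simps power_mult_distrib power_divide flip: power_mult)
    then have "gauss_weight a i u \<le> fact i / (a / 2) ^ i * exp (a / 2 * (norm u)\<^sup>2) * exp (- a * (norm u)\<^sup>2)"
      unfolding gauss_weight_def by (intro mult_right_mono) auto
    also have "\<dots> = fact i / (a / 2) ^ i * exp (- (a / 2) * (norm u)\<^sup>2)"
      by (simp add: mult.assoc flip: exp_add)
    finally show ?thesis .
  qed
  then show "AE u in lborel. norm (gauss_weight a i (u::'a)) \<le> norm (fact i / (a / 2) ^ i * exp (- (a / 2) * (norm u)\<^sup>2))"
    using assms by (auto simp: abs_of_nonneg)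
qed simp

text \<open>All radial moments are required at once, so that the class is closed under
  multiplication by even powers of the norm and every pairing with a Laguerre polynomial
  converges.\<close>

definition gauss_integrable :: "real \<Rightarrow> ('a::euclidean_space \<Rightarrow> complex) \<Rightarrow> bool" where
  "gauss_integrable a A \<longleftrightarrow> (\<forall>i. integrable lborel (\<lambda>u. A u * of_real (gauss_weight a i u)))"

lemma gauss_integrable_measurable:
  assumes "gauss_integrable a A" shows "A \<in> borel_measurable borel"
proof -
  have "integrable lborel (\<lambda>u. A u * of_real (gauss_weight a 0 u))"
    using assms by (simp add: gauss_integrable_def)
  then have [measurable]: "(\<lambda>u. A u * of_real (gauss_weight a 0 u)) \<in> borel_measurable borel"
    using borel_measurable_integrable by fastforce
  have "gauss_weight a 0 u * exp (a * (norm u)\<^sup>2) = 1" for u :: 'a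
    by (simp add: gauss_weight_def flip: exp_add)
  then have "A = (\<lambda>u. A u * of_real (gauss_weight a 0 u) * of_real (exp (a * (norm u)\<^sup>2)))"
    by (simp only: mult.assoc of_real_mult[symmetric]) simp
  also have "\<dots> \<in> borel_measurable borel" by measurable
  finally show ?thesis .
qed

lemma gauss_integrable_add:
  "gauss_integrable a A \<Longrightarrow> gauss_integrable a B \<Longrightarrow> gauss_integrable a (\<lambda>u. A u + B u)"
  unfolding gauss_integrable_def by (auto simp: distrib_right intro!: Bochner_Integration.integrable_add)

lemma gauss_integrable_cmult: "gauss_integrable a A \<Longrightarrow> gauss_integrable a (\<lambda>u. c * A u)"
  unfolding gauss_integrable_def by (auto simp: mult.assoc intro!: integrable_mult_right)

lemma gauss_integrable_0: "gauss_integrable a (\<lambda>_. 0)"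
  by (simp add: gauss_integrable_def)

lemma gauss_integrable_sum:
  "(\<And>j. j \<in> S \<Longrightarrow> gauss_integrable a (A j)) \<Longrightarrow> gauss_integrable a (\<lambda>u. \<Sum>j\<in>S. A j u)"
  by (induction S rule: infinite_finite_induct) (auto intro: gauss_integrable_add gauss_integrable_0)

text \<open>After the substitution v = \<rho> u the Gaussian only decays faster, since \<rho> \<le>
  1; the power of the norm costs a constant factor.\<close>

lemma gauss_integrable_dilate:
  assumes A: "gauss_integrable a A" and \<rho>: "0 < \<rho>" "\<rho> \<le> 1" and "a > 0"
  shows "gauss_integrable a (\<lambda>u. A (\<rho> *\<^sub>R u))"
  unfolding gauss_integrable_def
proof
  fix i
  note [measurable] = gauss_integrable_measurable[OF A]
  define f where "f v = A v * of_real (gauss_weight a i ((1 / \<rho>) *\<^sub>R v))" for v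
  have [measurable]: "f \<in> borel_measurable borel" unfolding f_def[abs_def] by measurable
  have "integrable lborel (\<lambda>v. of_real ((1 / \<rho>) ^ (2 * i)) * (A v * of_real (gauss_weight a i v)))"
    using A by (simp add: gauss_integrable_def)
  then have "integrable lborel f"
  proof (rule Bochner_Integration.integrable_bound)
    have "gauss_weight a i ((1 / \<rho>) *\<^sub>R v) \<le> (1 / \<rho>) ^ (2 * i) * gauss_weight a i v" for v :: 'a
    proof -
      have "norm v * 1 \<le> norm v * (1 / \<rho>)" using \<rho> by (intro mult_left_mono) auto
      then have "(norm v)\<^sup>2 \<le> (norm ((1 / \<rho>) *\<^sub>R v))\<^sup>2"
        using \<rho> by (intro power_mono) auto
      then have "exp (- a * (norm ((1 / \<rho>) *\<^sub>R v))\<^sup>2) \<le> exp (- a * (norm v)\<^sup>2)"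
        using \<open>a > 0\<close> by simp
      then have "norm ((1 / \<rho>) *\<^sub>R v) ^ (2 * i) * exp (- a * (norm ((1 / \<rho>) *\<^sub>R v))\<^sup>2)
          \<le> norm ((1 / \<rho>) *\<^sub>R v) ^ (2 * i) * exp (- a * (norm v)\<^sup>2)"
        by (intro mult_left_mono) auto
      then show ?thesis
        using \<rho> by (simp add: gauss_weight_def power_divide)
    qed
    then show "AE v in lborel. norm (f v) \<le> norm (of_real ((1 / \<rho>) ^ (2 * i)) * (A v * of_real (gauss_weight a i v)))"
      using \<rho> by (intro AE_I2)
        (simp add: f_def norm_mult norm_power mult.left_commute mult_left_mono norm_divide)
  qed simp
  then show "integrable lborel (\<lambda>u. A (\<rho> *\<^sub>R u) * of_real (gauss_weight a i u))"
    using integrable_lborel_dilate[of \<rho> f] \<rho> by (simp add: f_def)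
qed

section \<open>Homogeneous components and their radial moments\<close>

definition homogeneous_degree :: "nat \<Rightarrow> ('a::real_vector \<Rightarrow> complex) \<Rightarrow> bool" where
  "homogeneous_degree d A \<longleftrightarrow> (\<forall>\<rho>>0. \<forall>u. A (\<rho> *\<^sub>R u) = of_real (\<rho> ^ d) * A u)"

text \<open>Dilating by \<open>1 / sqrt 2\<close> and subtracting a multiple of the original function
  eliminates the top component.\<close>
lemma gauss_integrable_components:
  assumes "gauss_integrable a P" "a > 0"
    and "\<And>j. j < m \<Longrightarrow> homogeneous_degree (2 * j) (c j)" "\<And>u. P u = (\<Sum>j<m. c j u)" "j < m"
  shows "gauss_integrable a (c j)"
  using assms(1,3-)
proof (induction m arbitrary: P c j)
  case (Suc m)
  define \<rho> :: real where "\<rho> = sqrt (1 / 2)"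
  have \<rho>: "0 < \<rho>" "\<rho> \<le> 1" and \<rho>2: "\<rho> ^ (2 * j) = (1 / 2) ^ j" for j
    by (simp_all add: \<rho>_def power_mult)
  \<comment> \<open>The factor that \<open>c j\<close> acquires in Q. It is nonzero for
    \<open>j < m\<close> and vanishes for \<open>j = m\<close>.\<close>
  define b :: "nat \<Rightarrow> complex" where "b j = (1 / 2) ^ j - (1 / 2) ^ m" for j
  have b: "b j \<noteq> 0" if "j < m" for j
  proof -
    have "(1 / 2 :: real) ^ m < (1 / 2) ^ j" using that by simp
    then have "of_real ((1 / 2) ^ j) \<noteq> (of_real ((1 / 2) ^ m) :: complex)"
      unfolding of_real_eq_iff by linarith
    then show ?thesis by (simp add: b_def)
  qed
  define Q where "Q u = P (\<rho> *\<^sub>R u) + (- ((1 / 2) ^ m)) * P u" for u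
  have Q: "gauss_integrable a Q"
    unfolding Q_def using Suc.prems(1) assms(2) \<rho>
    by (intro gauss_integrable_add gauss_integrable_cmult gauss_integrable_dilate)
  have cj: "c j (\<rho> *\<^sub>R u) = (1 / 2) ^ j * c j u" if "j < Suc m" for j u
    using Suc.prems(2)[OF that] \<rho>(1) by (simp add: homogeneous_degree_def \<rho>2 del: of_real_power) simp
  have "Q u = (\<Sum>j<m. b j * c j u)" for u
    unfolding Q_def Suc.prems(3)
    by (simp add: cj b_def algebra_simps sum_distrib_left sum_distrib_right sum_subtractf)
  then have bc: "gauss_integrable a (\<lambda>u. b j * c j u)" if "j < m" for j
    using Suc.prems(2) that
    by (intro Suc.IH[OF Q, of "\<lambda>j u. b j * c j u"]) (auto simp: homogeneous_degree_def)
  have lower: "gauss_integrable a (c j)" if "j < m" for j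
    using gauss_integrable_cmult[OF bc[OF that], of "1 / b j"] b[OF that] by (simp add: mult.assoc[symmetric])
  have "gauss_integrable a (\<lambda>u. P u + (-1) * (\<Sum>j<m. c j u))"
    by (intro gauss_integrable_add gauss_integrable_cmult gauss_integrable_sum Suc.prems(1) lower) simp
  then have "gauss_integrable a (c m)" by (simp add: Suc.prems(3))
  with lower Suc.prems(4) show ?case by (metis less_SucE)
qed simp

text \<open>The derivative along the sequence 1 / (k + 1), as dominated convergence asks for
  sequences. The difference is reversed because it is applied to functions that decrease to the
  right of 0.\<close>

lemma difference_quotient_LIMSEQ:
  fixes f :: "real \<Rightarrow> real"
  assumes "(f has_real_derivative D) (at 0)"
  shows "(\<lambda>k. (f 0 - f (1 / Suc k)) / (1 / Suc k)) \<longlonglongrightarrow> - D"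
proof -
  have "(\<lambda>k. 1 / real (Suc k)) \<longlonglongrightarrow> 0" by real_asymp
  then have "filterlim (\<lambda>k. 1 / real (Suc k)) (at 0) sequentially"
    by (rule filterlim_atI) auto
  from filterlim_compose[OF assms[unfolded DERIV_def] this]
  have "(\<lambda>k. - ((f (0 + 1 / Suc k) - f 0) / (1 / Suc k))) \<longlonglongrightarrow> - D"
    by (rule tendsto_minus)
  then show ?thesis by (simp add: algebra_simps)
qed

text \<open>Write \<open>I h\<close> for the integral of \<open>A u * exp (- a * (1 + h) * (norm u)\<^sup>2)\<close>.  Substituting
  \<open>u / sqrt (1 + h)\<close> for \<open>u\<close> gives \<open>I h = (1 + h) powr (- (DIM('a) + d) / 2) * I 0\<close>; the
  lemma is the derivative of this identity at \<open>h = 0\<close>.\<close>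
lemma gauss_moment_step:
  fixes A :: "'a::euclidean_space \<Rightarrow> complex"
  assumes A: "gauss_integrable a A" and hom: "homogeneous_degree d A" and a: "a > 0"
  shows "(LINT u|lborel. A u * of_real (gauss_weight a 1 u))
       = of_real (real (DIM('a) + d) / (2 * a)) * (LINT u|lborel. A u * of_real (gauss_weight a 0 u))"
proof -
  note [measurable] = gauss_integrable_measurable[OF A]
  define N where "N = DIM('a) + d"
  define I where "I i = (LINT u|lborel. A u * of_real (gauss_weight a i u))" for i
  have int: "integrable lborel (\<lambda>u. A u * of_real (gauss_weight a i u))" for i
    using A by (simp add: gauss_integrable_def)
  define g where "g h u = exp (- a * (1 + h) * (norm (u::'a))\<^sup>2)" for h u
  have g0: "g 0 u = gauss_weight a 0 u" for u by (simp add: g_def gauss_weight_def)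
  \<comment> \<open>This is (1 + h)^(- N / 2), written with a natural exponent.\<close>
  define \<phi> where "\<phi> h = inverse (sqrt (1 + h) ^ N)" for h :: real
  have dil: "integrable lborel (\<lambda>u. A u * of_real (g h u))"
    "(LINT u|lborel. A u * of_real (g h u)) = of_real (\<phi> h) * I 0" if "h \<ge> 0" for h
  proof -
    define \<rho> where "\<rho> = sqrt (1 + h)"
    have \<rho>: "\<rho> > 0" "\<rho>\<^sup>2 = 1 + h" using that by (auto simp: \<rho>_def)
    define f where "f u = A u * of_real (gauss_weight a 0 u)" for u
    have [measurable]: "f \<in> borel_measurable borel" unfolding f_def[abs_def] by measurable
    have f: "f (\<rho> *\<^sub>R u) = of_real (\<rho> ^ d) * (A u * of_real (g h u))" for u
      using hom \<rho> by (simp add: f_def homogeneous_degree_def gauss_weight_def g_def power_mult_distrib mult_ac)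
    have "integrable lborel (\<lambda>u. f (\<rho> *\<^sub>R u))"
      unfolding integrable_lborel_dilate[OF \<rho>(1) \<open>f \<in> borel_measurable borel\<close>]
      using int[of 0] by (simp add: f_def[abs_def])
    from integrable_mult_right[OF this, of "of_real (inverse (\<rho> ^ d))"]
    show "integrable lborel (\<lambda>u. A u * of_real (g h u))"
      using \<rho>(1) by (simp add: f field_simps)
    have "I 0 = \<rho> ^ DIM('a) *\<^sub>R (LINT u|lborel. f (\<rho> *\<^sub>R u))"
      using integral_lborel_dilate[OF \<rho>(1), of f] by (simp add: f_def I_def)
    also have "\<dots> = of_real (\<rho> ^ N) * (LINT u|lborel. A u * of_real (g h u))"
      by (simp add: f N_def power_add scaleR_conv_of_real mult.assoc)
    finally show "(LINT u|lborel. A u * of_real (g h u)) = of_real (\<phi> h) * I 0"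
      using \<rho>(1) by (simp add: \<phi>_def \<rho>_def field_simps)
  qed
  define h where "h k = 1 / real (Suc k)" for k
  have h: "h k > 0" for k by (simp add: h_def)
  define S where "S k u = A u * of_real ((g 0 u - g (h k) u) / h k)" for k u
  have [measurable]: "S k \<in> borel_measurable borel" for k unfolding S_def[abs_def] g_def by measurable
  have S_int: "(LINT u|lborel. S k u) = of_real ((\<phi> 0 - \<phi> (h k)) / h k) * I 0" for k
  proof -
    have "S k u = of_real (1 / h k) * (A u * of_real (g 0 u) - A u * of_real (g (h k) u))" for u
      using h[of k] by (simp add: S_def field_simps)
    then have "(LINT u|lborel. S k u) = of_real (1 / h k) * (of_real (\<phi> 0) * I 0 - of_real (\<phi> (h k)) * I 0)"
      using h[of k] by (simp add: dil less_imp_le)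
    then show ?thesis using h[of k] by (simp add: field_simps)
  qed
  have S_lim: "(\<lambda>k. S k u) \<longlonglongrightarrow> A u * of_real (a * gauss_weight a 1 u)" for u
  proof -
    have "((\<lambda>h. g h u) has_real_derivative - (a * gauss_weight a 1 u)) (at 0)"
      unfolding g_def by (auto intro!: derivative_eq_intros simp: gauss_weight_def)
    from difference_quotient_LIMSEQ[OF this]
    show ?thesis unfolding S_def h_def
      by (intro tendsto_mult tendsto_const tendsto_of_real) simp
  qed
  \<comment> \<open>By 1 - exp (- y) \<le> y for y \<ge> 0, the quotients are dominated, uniformly
    in k, by the integrand of the first moment.\<close>
  have S_bound: "norm (S k u) \<le> norm (A u * of_real (a * gauss_weight a 1 u))" for k u
  proof -
    define x where "x = a * (norm u)\<^sup>2"
    have x: "x \<ge> 0" using a by (simp add: x_def)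
    have g': "g h u = exp (- x) * exp (- (x * h))" for h
      by (simp add: g_def x_def flip: exp_add) (simp add: algebra_simps)
    have "1 - exp (- (x * h k)) \<le> x * h k" "exp (- (x * h k)) \<le> 1"
      using exp_ge_add_one_self[of "- (x * h k)"] x h[of k] by (auto simp: mult_nonneg_nonneg)
    moreover have "g 0 u - g (h k) u = exp (- x) * (1 - exp (- (x * h k)))"
      unfolding g' by (simp add: algebra_simps)
    ultimately have "\<bar>g 0 u - g (h k) u\<bar> \<le> exp (- x) * (x * h k)"
      by (simp add: abs_mult)
    then have "\<bar>(g 0 u - g (h k) u) / h k\<bar> \<le> a * gauss_weight a 1 u"
      using h[of k] by (simp add: abs_div field_simps gauss_weight_def x_def power2_eq_square)
    moreover have "0 \<le> a * gauss_weight a 1 u" using a by simp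
    ultimately show ?thesis unfolding S_def norm_mult norm_of_real
      by (intro mult_left_mono) auto
  qed
  have "(\<lambda>k. LINT u|lborel. S k u) \<longlonglongrightarrow> (LINT u|lborel. A u * of_real (a * gauss_weight a 1 u))"
  proof (rule integral_dominated_convergence)
    show "integrable lborel (\<lambda>u. norm (A u * of_real (a * gauss_weight a 1 u)))"
      using integrable_mult_right[OF int[of 1], of "of_real a"]
      by (intro integrable_norm) (simp add: mult.left_commute)
  qed (use S_lim S_bound in auto)
  also have "(LINT u|lborel. A u * of_real (a * gauss_weight a 1 u)) = of_real a * I 1"
    unfolding I_def integral_mult_right_zero[symmetric]
    by (intro Bochner_Integration.integral_cong refl) (simp add: mult.left_commute)
  finally have 1: "(\<lambda>k. LINT u|lborel. S k u) \<longlonglongrightarrow> of_real a * I 1" .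
  \<comment> \<open>The same limit is now evaluated through the closed form
    \<open>S_int\<close>.\<close>
  have "(\<phi> has_real_derivative - (N / 2)) (at 0)"
    unfolding \<phi>_def by (auto intro!: derivative_eq_intros)
  from difference_quotient_LIMSEQ[OF this]
  have "(\<lambda>k. of_real ((\<phi> 0 - \<phi> (h k)) / h k) * I 0) \<longlonglongrightarrow> of_real (N / 2) * I 0"
    unfolding h_def by (intro tendsto_mult tendsto_const tendsto_of_real) simp
  then have "(\<lambda>k. LINT u|lborel. S k u) \<longlonglongrightarrow> of_real (N / 2) * I 0"
    unfolding S_int .
  from LIMSEQ_unique[OF 1 this] show ?thesis
    using a by (simp add: I_def N_def field_simps)
qed

text \<open>Multiplying A by |u|^(2 i) raises its degree by 2 i, so iterating
  \<open>gauss_moment_step\<close> multiplies by ((DIM + d) / 2 + i) / a each time; these factors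
  build up the Pochhammer symbol.\<close>

lemma gauss_moment:
  fixes A :: "'a::euclidean_space \<Rightarrow> complex"
  assumes A: "gauss_integrable a A" and hom: "homogeneous_degree d A" and a: "a > 0"
  shows "(LINT u|lborel. A u * of_real (gauss_weight a i u))
       = of_real (pochhammer (real (DIM('a) + d) / 2) i / a ^ i) * (LINT u|lborel. A u * of_real (gauss_weight a 0 u))"
proof (induction i)
  case (Suc i)
  define B where "B u = A u * of_real (norm u ^ (2 * i))" for u
  have B: "B u * of_real (gauss_weight a k u) = A u * of_real (gauss_weight a (k + i) u)" for u k
    unfolding B_def gauss_weight_add[symmetric] by simp
  have "gauss_integrable a B"
    using A by (simp add: gauss_integrable_def B)
  moreover have "homogeneous_degree (d + 2 * i) B"
    using hom by (simp add: homogeneous_degree_def B_def power_mult_distrib power_add)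
  ultimately have "(LINT u|lborel. B u * of_real (gauss_weight a 1 u))
       = of_real (real (DIM('a) + (d + 2 * i)) / (2 * a)) * (LINT u|lborel. B u * of_real (gauss_weight a 0 u))"
    using a by (rule gauss_moment_step)
  then have "(LINT u|lborel. A u * of_real (gauss_weight a (Suc i) u))
       = of_real (real (DIM('a) + (d + 2 * i)) / (2 * a)) * (LINT u|lborel. A u * of_real (gauss_weight a i u))"
    unfolding B by simp
  moreover have "real (DIM('a) + (d + 2 * i)) / (2 * a) = (real (DIM('a) + d) / 2 + real i) / a"
    using a by (simp add: field_simps)
  ultimately show ?case
    unfolding Suc by (simp only: pochhammer_Suc power_Suc) (simp add: field_simps)
qed simp

lemma gauss_integrable_laguerre:
  assumes "gauss_integrable a A"
  shows "integrable lborel (\<lambda>u. A u * of_real (gen_laguerre n M (a * (norm u)\<^sup>2) * gauss_weight a 0 u))"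
    and "(LINT u|lborel. A u * of_real (gen_laguerre n M (a * (norm u)\<^sup>2) * gauss_weight a 0 u))
       = (\<Sum>i\<le>M. of_real ((-1) ^ i * real ((M + n) choose (M - i)) / fact i * a ^ i)
            * (LINT u|lborel. A u * of_real (gauss_weight a i u)))"
proof -
  have eq: "A u * of_real (gen_laguerre n M (a * (norm u)\<^sup>2) * gauss_weight a 0 u)
      = (\<Sum>i\<le>M. of_real ((-1) ^ i * real ((M + n) choose (M - i)) / fact i * a ^ i)
            * (A u * of_real (gauss_weight a i u)))" for u
    unfolding gen_laguerre_def sum_distrib_right of_real_sum sum_distrib_left
    by (intro sum.cong refl) (simp add: gauss_weight_def power_mult_distrib mult_ac flip: power_mult)
  have int: "integrable lborel (\<lambda>u. c * (A u * of_real (gauss_weight a i u)))" for c i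
    using assms by (intro integrable_mult_right) (simp add: gauss_integrable_def)
  show "integrable lborel (\<lambda>u. A u * of_real (gen_laguerre n M (a * (norm u)\<^sup>2) * gauss_weight a 0 u))"
    unfolding eq by (intro Bochner_Integration.integrable_sum int)
  show "(LINT u|lborel. A u * of_real (gen_laguerre n M (a * (norm u)\<^sup>2) * gauss_weight a 0 u))
       = (\<Sum>i\<le>M. of_real ((-1) ^ i * real ((M + n) choose (M - i)) / fact i * a ^ i)
            * (LINT u|lborel. A u * of_real (gauss_weight a i u)))"
    unfolding eq by (subst Bochner_Integration.integral_sum[OF int]) simp
qed

text \<open>In the moments the powers of a cancel, and sign, factorial and Pochhammer symbol combine
  into the binomial coefficient of - (n + j) over i. Vandermonde's identity sums the products to the
  binomial coefficient of M - j over M, which is 0 for 0 < j \<le> M and 1 for j = 0.\<close>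

lemma laguerre_gauss_moment:
  fixes A :: "'a::euclidean_space \<Rightarrow> complex"
  assumes A: "gauss_integrable a A" and hom: "homogeneous_degree (2 * j) A" and a: "a > 0"
    and dim: "DIM('a) = 2 * n" and "j \<le> M"
  shows "(LINT u|lborel. A u * of_real (gen_laguerre n M (a * (norm u)\<^sup>2) * gauss_weight a 0 u))
       = (if j = 0 then LINT u|lborel. A u * of_real (gauss_weight a 0 u) else 0)"
proof -
  define I where "I i = (LINT u|lborel. A u * of_real (gauss_weight a i u))" for i
  have half: "real (DIM('a) + 2 * j) / 2 = real (n + j)" by (simp add: dim)
  have I: "I i = of_real (pochhammer (real (n + j)) i / a ^ i) * I 0" for i
    using gauss_moment[OF A hom a, of i] unfolding half I_def .
  have "(LINT u|lborel. A u * of_real (gen_laguerre n M (a * (norm u)\<^sup>2) * gauss_weight a 0 u))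
      = (\<Sum>i\<le>M. of_real ((-1) ^ i * real ((M + n) choose (M - i)) / fact i * a ^ i) * I i)"
    unfolding gauss_integrable_laguerre(2)[OF A] I_def ..
  also have "\<dots> = (\<Sum>i\<le>M. of_real ((- real (n + j) gchoose i) * (real (M + n) gchoose (M - i))) * I 0)"
  proof (intro sum.cong refl)
    fix i
    have "(-1) ^ i * real ((M + n) choose (M - i)) / fact i * a ^ i * (pochhammer (real (n + j)) i / a ^ i)
        = (- real (n + j) gchoose i) * (real (M + n) gchoose (M - i))"
      using a unfolding gbinomial_pochhammer[of "- real (n + j)"] binomial_gbinomial by (simp add: add.commute)
    then show "of_real ((-1) ^ i * real ((M + n) choose (M - i)) / fact i * a ^ i) * I i
        = of_real ((- real (n + j) gchoose i) * (real (M + n) gchoose (M - i))) * I 0"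
      unfolding I[of i] mult.assoc[symmetric] of_real_mult[symmetric] by simp
  qed
  also have "\<dots> = of_real (\<Sum>i=0..M. (- real (n + j) gchoose i) * (real (M + n) gchoose (M - i))) * I 0"
    by (simp add: sum_distrib_right atMost_atLeast0)
  also have "(\<Sum>i=0..M. (- real (n + j) gchoose i) * (real (M + n) gchoose (M - i)))
      = (- real (n + j) + real (M + n)) gchoose M"
    by (rule gbinomial_Vandermonde)
  also have "- real (n + j) + real (M + n) = real (M - j)"
    using \<open>j \<le> M\<close> by simp
  also have "real (M - j) gchoose M = real ((M - j) choose M)"
    by (rule binomial_gbinomial[symmetric])
  also have "\<dots> = (if j = 0 then 1 else 0)"
    using \<open>j \<le> M\<close> by (auto simp: binomial_eq_0)
  finally show ?thesis by (simp add: I_def)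
qed

section \<open>The reproducing property\<close>

lemma norm_scalar_mult_vec: "norm (c *s u) = cmod c * norm u" for u :: "complex ^ 'n::finite"
  by (simp add: norm_vec_def norm_mult L2_set_right_distrib)

lemma orthogonal_transformation_scalar_mult:
  "cmod c = 1 \<Longrightarrow> orthogonal_transformation (\<lambda>u :: complex ^ 'n::finite. c *s u)"
  unfolding orthogonal_transformation
  by (auto intro!: linearI simp: norm_scalar_mult_vec vec_eq_iff algebra_simps)

lemma scaleR_eq_scalar_mult: "\<rho> *\<^sub>R u = of_real \<rho> *s u" for u :: "complex ^ 'n"
  unfolding vec_eq_iff vector_scaleR_component vector_smult_component by (simp add: scaleR_conv_of_real)

lemma gauss_weight_scalar_mult: "cmod c = 1 \<Longrightarrow> gauss_weight a i (c *s u) = gauss_weight a i u"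
  for u :: "complex ^ 'n::finite"
  by (simp add: gauss_weight_def norm_scalar_mult_vec)

lemma continuous_on_unit_circle_scalar_mult:
  "continuous_on S (\<lambda>p. unit_circle (fst p) *s (snd p :: complex ^ 'n::finite))"
  unfolding vector_scalar_mult_def
  by (intro continuous_on_vec_lambda continuous_intros continuous_on_compose2[OF continuous_on_unit_circle]) auto

text \<open>Fubini on {0..1} times the space: each rotation preserves Lebesgue measure and the
  weight, so the inner integral over u does not depend on t.\<close>

lemma circle_average_integral:
  fixes F :: "complex ^ 'n::finite \<Rightarrow> complex"
  assumes F: "continuous_on UNIV F" and int: "integrable lborel (\<lambda>u. F u * of_real (gauss_weight a i u))"
    and P: "\<And>u. ((\<lambda>t. F (unit_circle t *s u)) has_integral P u) {0..1}"
  shows "integrable lborel (\<lambda>u. P u * of_real (gauss_weight a i u))"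
    and "(LINT u|lborel. P u * of_real (gauss_weight a i u)) = (LINT u|lborel. F u * of_real (gauss_weight a i u))"
proof -
  have [measurable]: "F \<in> borel_measurable borel"
    using F by (rule borel_measurable_continuous_onI)
  define H where "H p = indicator {0..1} (fst p) *\<^sub>R
      (F (unit_circle (fst p) *s snd p) * of_real (gauss_weight a i (snd p)))" for p :: "real \<times> (complex ^ 'n)"
  have "(\<lambda>p. F (unit_circle (fst p) *s snd p)) \<in> borel_measurable borel"
    by (intro borel_measurable_continuous_onI continuous_on_compose2[OF F]
        continuous_on_unit_circle_scalar_mult) auto
  then have [measurable]: "(\<lambda>p. F (unit_circle (fst p) *s snd p)) \<in> borel_measurable (lborel \<Otimes>\<^sub>M lborel)"
    by (simp add: lborel_prod)
  have [measurable]: "H \<in> borel_measurable (lborel \<Otimes>\<^sub>M lborel)"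
    unfolding H_def[abs_def] by measurable
  define Fw where "Fw u = F u * of_real (gauss_weight a i u)" for u
  have [measurable]: "Fw \<in> borel_measurable borel" unfolding Fw_def[abs_def] by measurable
  have H: "H (t, u) = indicator {0..1} t *\<^sub>R Fw (unit_circle t *s u)" for t u
    by (simp add: H_def Fw_def gauss_weight_scalar_mult)
  note orth = orthogonal_transformation_scalar_mult[OF norm_unit_circle]
  have iF: "integrable lborel Fw" using int by (simp add: Fw_def[abs_def])
  have i2: "integrable lborel (\<lambda>u. Fw (unit_circle t *s u))" for t
    unfolding integrable_lborel_orthogonal[OF orth \<open>Fw \<in> borel_measurable borel\<close>] by (rule iF)
  have nFw: "(\<lambda>u. norm (Fw u)) \<in> borel_measurable borel" by measurable
  have HI: "integrable (lborel \<Otimes>\<^sub>M lborel) H"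
  proof (rule lborel_pair.Fubini_integrable)
    have "(LINT u|lborel. norm (H (t, u))) = indicator {0..1} t *\<^sub>R (LINT u|lborel. norm (Fw u))" for t
      unfolding H norm_scaleR using integral_lborel_orthogonal[OF orth nFw, of t] by simp
    then show "integrable lborel (\<lambda>t. LINT u|lborel. norm (H (t, u)))"
      by (simp add: integrable_indicator_iff)
    show "AE t in lborel. integrable lborel (\<lambda>u. H (t, u))"
      unfolding H using i2 by (intro AE_I2 integrable_scaleR_right)
  qed measurable
  have Hu: "(LINT u|lborel. H (t, u)) = indicator {0..1} t *\<^sub>R (LINT u|lborel. Fw u)" for t
    unfolding H using integral_lborel_orthogonal[OF orth \<open>Fw \<in> borel_measurable borel\<close>, of t] by simp
  \<comment> \<open>The average P is given as a gauge integral; continuity in t identifies it with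
    the Lebesgue integral that Fubini produces.\<close>
  have PH: "(LINT t|lborel. H (t, u)) = P u * of_real (gauss_weight a i u)" for u
  proof -
    have "continuous_on {0..1} (\<lambda>t. F (unit_circle t *s u))"
      using continuous_on_compose2[OF F continuous_on_compose2[OF continuous_on_unit_circle_scalar_mult[of UNIV],
          of "{0..1}" "\<lambda>t. (t, u)"]]
      by (simp add: continuous_on_Pair)
    then have "set_integrable lborel {0..1} (\<lambda>t. F (unit_circle t *s u))"
      by (rule borel_integrable_atLeastAtMost')
    from set_borel_integral_eq_integral(2)[OF this] P[of u]
    have "(LINT t|lborel. indicator {0..1} t *\<^sub>R F (unit_circle t *s u)) = P u"
      by (simp add: set_lebesgue_integral_def integral_unique)
    moreover have "H (t, u) = (indicator {0..1} t *\<^sub>R F (unit_circle t *s u)) * of_real (gauss_weight a i u)" for t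
      by (simp add: H_def)
    ultimately show ?thesis by (simp only: integral_mult_left_zero)
  qed
  have HI': "integrable (lborel \<Otimes>\<^sub>M lborel) (\<lambda>(t, u). H (t, u))" using HI by simp
  show "integrable lborel (\<lambda>u. P u * of_real (gauss_weight a i u))"
    using lborel_pair.integrable_snd[OF HI'] by (simp add: PH)
  have "(LINT u|lborel. P u * of_real (gauss_weight a i u)) = (LINT t|lborel. LINT u|lborel. H (t, u))"
    using lborel_pair.Fubini_integral[OF HI'] by (simp add: PH)
  also have "\<dots> = (LINT t::real|lborel. indicator {0..1} t *\<^sub>R (LINT u|lborel. Fw u))"
    unfolding Hu ..
  also have "\<dots> = (LINT u|lborel. Fw u)"
    by simp
  finally show "(LINT u|lborel. P u * of_real (gauss_weight a i u)) = (LINT u|lborel. F u * of_real (gauss_weight a i u))"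
    by (simp add: Fw_def)
qed

text \<open>By x y \<le> x^2 + y^2 with x = |F u| and y = |u|^(2 i), the integrand is bounded by the
  square-integrable term plus a Gaussian moment of index 2 i.\<close>

lemma square_gauss_integrable:
  fixes F :: "'a::euclidean_space \<Rightarrow> complex"
  assumes [measurable]: "F \<in> borel_measurable borel" and a: "a > 0"
    and sq: "integrable lborel (\<lambda>u. (cmod (F u))\<^sup>2 * exp (- a * (norm u)\<^sup>2))"
  shows "gauss_integrable a F"
  unfolding gauss_integrable_def
proof
  fix i
  have "integrable lborel (\<lambda>u. (cmod (F u))\<^sup>2 * exp (- a * (norm u)\<^sup>2) + gauss_weight a (2 * i) u)"
    by (intro Bochner_Integration.integrable_add sq integrable_gauss_weight a)
  then show "integrable lborel (\<lambda>u. F u * of_real (gauss_weight a i u))"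
  proof (rule Bochner_Integration.integrable_bound)
    have "cmod (F u) * gauss_weight a i u \<le> (cmod (F u))\<^sup>2 * exp (- a * (norm u)\<^sup>2) + gauss_weight a (2 * i) u" for u
    proof -
      define x y where "x = cmod (F u)" and "y = norm u ^ (2 * i)"
      have "0 \<le> x" "0 \<le> y" by (simp_all add: x_def y_def)
      then have "x * y \<le> x\<^sup>2 + y\<^sup>2"
        using sum_squares_bound[of x y] mult_nonneg_nonneg[of x y] by linarith
      then have "(x * y) * exp (- a * (norm u)\<^sup>2) \<le> (x\<^sup>2 + y\<^sup>2) * exp (- a * (norm u)\<^sup>2)"
        by (intro mult_right_mono) auto
      then show ?thesis
        by (simp add: x_def y_def gauss_weight_def distrib_right mult.assoc mult_2 power_add power2_eq_square)
    qed
    then show "AE u in lborel. norm (F u * of_real (gauss_weight a i u))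
        \<le> norm ((cmod (F u))\<^sup>2 * exp (- a * (norm u)\<^sup>2) + gauss_weight a (2 * i) u)"
      by (intro AE_I2) (simp add: norm_mult)
  qed measurable
qed

text \<open>The difference is a polynomial in \<rho>^2 with infinitely many zeros. This uniqueness
  is what makes the coefficients of the circle averages homogeneous in u.\<close>

lemma polynomial_positive_coeffs_eq:
  fixes c d :: "nat \<Rightarrow> complex"
  assumes "\<And>\<rho>::real. \<rho> > 0 \<Longrightarrow> (\<Sum>j<m. c j * of_real (\<rho> ^ (2 * j))) = (\<Sum>j<m. d j * of_real (\<rho> ^ (2 * j)))"
    and "j < m"
  shows "c j = d j"
proof (rule ccontr)
  assume "c j \<noteq> d j"
  define p where "p = (\<Sum>j<m. monom (c j - d j) j)"
  have "coeff p j = c j - d j"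
    using \<open>j < m\<close> by (simp add: p_def coeff_sum)
  then have "p \<noteq> 0" using \<open>c j \<noteq> d j\<close> by auto
  then have "finite {x. poly p x = 0}" by (rule poly_roots_finite)
  moreover have "of_real ` {0<..} \<subseteq> {x. poly p x = 0}"
  proof safe
    fix x :: real assume "x > 0"
    then have "(\<Sum>j<m. c j * of_real (x ^ j)) = (\<Sum>j<m. d j * of_real (x ^ j))"
      using assms(1)[of "sqrt x"] by (simp add: power_mult)
    then show "poly p (of_real x) = 0"
      by (simp add: p_def poly_sum poly_monom algebra_simps sum_subtractf)
  qed
  moreover have "infinite ((of_real :: real \<Rightarrow> complex) ` {0<..})"
    by (simp add: finite_image_iff inj_on_def infinite_Ioi)
  ultimately show False using finite_subset by blast
qed

lemma laguerre_reproduces_origin: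
  fixes F :: "complex ^ 'n::finite \<Rightarrow> complex"
  assumes F: "continuous_on UNIV F" and a: "a > 0" and m: "m \<ge> 1"
    and sq: "integrable lborel (\<lambda>u. (cmod (F u))\<^sup>2 * exp (- a * (norm u)\<^sup>2))"
    and avg: "\<And>u. \<exists>c. c 0 = F 0 \<and> (\<forall>\<rho>>0. ((\<lambda>t. F ((of_real \<rho> * unit_circle t) *s u))
         has_integral (\<Sum>j<m. c j * of_real (\<rho> ^ (2 * j)))) {0..1})"
  shows "(LINT u|lborel. F u * of_real (gen_laguerre CARD('n) (m - 1) (a * (norm u)\<^sup>2) * exp (- a * (norm u)\<^sup>2)))
       = of_real ((pi / a) ^ CARD('n)) * F 0"
proof -
  define L where "L u = gen_laguerre CARD('n) (m - 1) (a * (norm u)\<^sup>2) * gauss_weight a 0 u" for u :: "complex ^ 'n"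
  \<comment> \<open>The coefficients are chosen for each u separately, so at this point nothing is
    known about how they depend on u.\<close>
  have "\<exists>c. \<forall>u. c u 0 = F 0 \<and> (\<forall>\<rho>>0. ((\<lambda>t. F ((of_real \<rho> * unit_circle t) *s u))
         has_integral (\<Sum>j<m. c u j * of_real (\<rho> ^ (2 * j)))) {0..1})"
    using avg by (intro choice) simp
  then obtain c where c0: "\<And>u. c u 0 = F 0" and
    c: "\<And>u \<rho>. \<rho> > 0 \<Longrightarrow> ((\<lambda>t. F ((of_real \<rho> * unit_circle t) *s u))
         has_integral (\<Sum>j<m. c u j * of_real (\<rho> ^ (2 * j)))) {0..1}"
    by blast
  define C where "C j u = c u j" for j u
  define P where "P u = (\<Sum>j<m. C j u)" for u
  have P: "((\<lambda>t. F (unit_circle t *s u)) has_integral P u) {0..1}" for u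
    using c[of 1 u] by (simp add: P_def C_def)
  have hom: "homogeneous_degree (2 * j) (C j)" if "j < m" for j
    unfolding homogeneous_degree_def
  proof (intro allI impI)
    \<comment> \<open>The average at radius \<rho> along \<open>s *\<^sub>R u\<close> is the average
      at radius \<rho> s along u; comparing coefficients of powers of \<rho> gives
      homogeneity.\<close>
    fix s :: real and u assume s: "s > 0"
    have "(\<Sum>j<m. c (s *\<^sub>R u) j * of_real (\<rho> ^ (2 * j)))
        = (\<Sum>j<m. (of_real (s ^ (2 * j)) * c u j) * of_real (\<rho> ^ (2 * j)))" if \<rho>: "\<rho> > 0" for \<rho> :: real
    proof -
      have "(of_real \<rho> * unit_circle t) *s (s *\<^sub>R u) = (of_real (\<rho> * s) * unit_circle t) *s u" for t
        by (simp add: scaleR_eq_scalar_mult vec_eq_iff mult_ac)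
      with c[of "\<rho> * s" u] c[OF \<rho>, of "s *\<^sub>R u"] s \<rho>
      have "(\<Sum>j<m. c (s *\<^sub>R u) j * of_real (\<rho> ^ (2 * j))) = (\<Sum>j<m. c u j * of_real ((\<rho> * s) ^ (2 * j)))"
        by (auto intro: has_integral_unique)
      then show ?thesis by (simp add: power_mult_distrib mult_ac)
    qed
    from polynomial_positive_coeffs_eq[OF this that]
    show "C j (s *\<^sub>R u) = of_real (s ^ (2 * j)) * C j u" unfolding C_def .
  qed
  have gF: "gauss_integrable a F"
    using F a sq by (intro square_gauss_integrable borel_measurable_continuous_onI)
  have intF: "integrable lborel (\<lambda>u. F u * of_real (gauss_weight a i u))" for i
    using gF by (simp add: gauss_integrable_def)
  have gP: "gauss_integrable a P"
    unfolding gauss_integrable_def using circle_average_integral(1)[OF F intF P] by blast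
  \<comment> \<open>This gives measurability of the chosen coefficients along with their
    integrability.\<close>
  have gC: "gauss_integrable a (C j)" if "j < m" for j
    using gauss_integrable_components[OF gP a hom P_def that] .
  have dim: "DIM(complex ^ 'n) = 2 * CARD('n)" by simp
  have "(LINT u|lborel. F u * of_real (L u)) = (LINT u|lborel. P u * of_real (L u))"
    unfolding L_def gauss_integrable_laguerre(2)[OF gF] gauss_integrable_laguerre(2)[OF gP]
      circle_average_integral(2)[OF F intF P] ..
  also have "\<dots> = (\<Sum>j<m. LINT u|lborel. C j u * of_real (L u))"
    unfolding P_def sum_distrib_right L_def
    by (rule Bochner_Integration.integral_sum, rule gauss_integrable_laguerre(1), rule gC) simp
  also have "\<dots> = (\<Sum>j<m. if j = 0 then LINT u|lborel. C j u * of_real (gauss_weight a 0 u) else 0)"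
    unfolding L_def by (intro sum.cong refl laguerre_gauss_moment[OF gC hom a dim]) auto
  also have "\<dots> = (LINT u|lborel. C 0 u * of_real (gauss_weight a 0 u))"
    using m by (subst sum.delta) auto
  also have "\<dots> = F 0 * of_real (LINT u|lborel. exp (- a * (norm (u :: complex ^ 'n))\<^sup>2))"
    by (simp add: C_def c0 gauss_weight_def)
  also have "(LINT u|lborel. exp (- a * (norm (u :: complex ^ 'n))\<^sup>2)) = sqrt (pi / a) ^ (2 * CARD('n))"
    using has_bochner_integral_integral_eq[OF has_bochner_integral_gaussian[OF a, where 'a="complex ^ 'n"]]
    by (simp only: dim)
  also have "\<dots> = (pi / a) ^ CARD('n)"
    using a by (simp add: power_mult)
  finally show ?thesis by (simp add: L_def gauss_weight_def mult.commute)
qed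

declare polyanalytic.simps [simp del]

section \<open>The explicit kernel\<close>

text \<open>The claimed kernel with the sum over \<open>J m\<close> already in closed form;
  \<open>explicit_kernel_eq_sum\<close> expands it again.\<close>

definition explicit_kernel :: "real \<Rightarrow> nat \<Rightarrow> complex ^ 'n::finite \<Rightarrow> complex ^ 'n \<Rightarrow> complex" where
  "explicit_kernel a m z w =
     exp (of_real a * (\<Sum>r\<in>UNIV. w $ r * cnj (z $ r)))
     * of_real (gen_laguerre CARD('n) (m - 1) (a * (norm (w - z))\<^sup>2))"

lemma cnj_explicit_kernel: "cnj (explicit_kernel a m z w) = explicit_kernel a m w z"
  by (simp add: explicit_kernel_def exp_cnj norm_minus_commute mult.commute)

lemma norm_vec_square: "(norm v)\<^sup>2 = (\<Sum>r\<in>UNIV. (cmod (v $ r))\<^sup>2)" for v :: "complex ^ 'n::finite"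
  by (simp add: norm_vec_def L2_set_def sum_nonneg)

lemma of_real_norm_vec_square: "of_real ((norm v)\<^sup>2) = (\<Sum>r\<in>UNIV. v $ r * cnj (v $ r))"
  for v :: "complex ^ 'n::finite"
  by (simp add: norm_vec_square complex_norm_square[symmetric] del: of_real_power)

text \<open>The exponential is holomorphic in w, and |w - z|^2 has degree one in the conjugate
  variables, so a polynomial of degree m - 1 in it has order m.\<close>

lemma polyanalytic_explicit_kernel:
  assumes "m \<ge> 1" shows "polyanalytic m (explicit_kernel a m z)"
proof -
  have lin: "polyanalytic (Suc 0) (\<lambda>w. w $ r + c)" for r :: 'a and c
    by (intro polyanalytic_add polyanalytic_nth polyanalytic_const)
  have cl: "polyanalytic (Suc (Suc 0)) (\<lambda>w. cnj (w $ r) + c)" for r :: 'a and c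
    by (intro polyanalytic_add polyanalytic_cnj_nth polyanalytic_const)
  define E where "E w = exp (of_real a * (\<Sum>r\<in>UNIV. w $ r * cnj (z $ r)))" for w
  define Q where "Q w = (\<Sum>r\<in>UNIV. (w $ r + - (z $ r)) * (cnj (w $ r) + - cnj (z $ r)))" for w
  define b :: "nat \<Rightarrow> complex" where
    "b i = of_real ((-1) ^ i * real ((m - 1 + CARD('a)) choose (m - 1 - i)) / fact i * a ^ i)" for i
  have e: "polyanalytic (Suc 0) E"
    unfolding E_def
    by (intro polyanalytic_exp polyanalytic_sum
        polyanalytic_mult[of 0 _ 0, simplified add_0] polyanalytic_const polyanalytic_nth)
  have q: "polyanalytic (Suc (Suc 0)) Q"
    unfolding Q_def by (intro polyanalytic_sum polyanalytic_mult[OF lin cl, unfolded add_0])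
  have t: "polyanalytic (Suc (m - 1)) (\<lambda>w. b i * Q w ^ i)" if "i \<le> m - 1" for i
  proof -
    have "polyanalytic (Suc (m - 1)) (\<lambda>w. Q w ^ i)"
      using that by (intro polyanalytic_mono[OF polyanalytic_power[OF q, of i]]) simp
    from polyanalytic_mult[OF polyanalytic_const[of 0] this] show ?thesis by simp
  qed
  have "polyanalytic (Suc (m - 1)) (\<lambda>w. \<Sum>i\<le>m-1. b i * Q w ^ i)"
    by (rule polyanalytic_sum, rule t) simp
  from polyanalytic_mult[OF e this]
  have "polyanalytic m (\<lambda>w. E w * (\<Sum>i\<le>m-1. b i * Q w ^ i))"
    using assms by simp
  moreover have "explicit_kernel a m z = (\<lambda>w. E w * (\<Sum>i\<le>m-1. b i * Q w ^ i))"
  proof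
    fix w
    have Q: "Q w = of_real ((norm (w - z))\<^sup>2)"
      unfolding of_real_norm_vec_square Q_def by simp
    show "explicit_kernel a m z w = E w * (\<Sum>i\<le>m-1. b i * Q w ^ i)"
      unfolding explicit_kernel_def E_def gen_laguerre_def of_real_sum Q b_def
      by (intro arg_cong2[where f=times] sum.cong refl) (simp add: power_mult_distrib)
  qed
  ultimately show ?thesis by simp
qed

text \<open>Shifts the Gaussian exponent together with that of the conjugated kernel to the centre
  z: a centred Gaussian remains, and the factor exp (- a <u, z>) is left for the translated
  function.\<close>

lemma exponent_translate:
  fixes z u :: "complex ^ 'n::finite"
  shows "of_real (- a * (norm (z + u))\<^sup>2) + of_real a * (\<Sum>r\<in>UNIV. z $ r * cnj ((z + u) $ r))
       = - (of_real a * (\<Sum>r\<in>UNIV. u $ r * cnj (z $ r))) + of_real (- a * (norm u)\<^sup>2)"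
  unfolding of_real_mult of_real_norm_vec_square
  by (simp add: algebra_simps sum.distrib)

text \<open>Completing the square turns the integrand into exp (a |z|^2) times a translate by z of a
  squared Laguerre polynomial against the Gaussian, which is a finite sum of integrable
  moments.\<close>

lemma explicit_kernel_square_integrable:
  assumes "a > 0"
  shows "integrable lborel (\<lambda>w. (cmod (explicit_kernel a m z w))\<^sup>2 * exp (- a * (norm w)\<^sup>2))"
proof -
  define L where "L u = gen_laguerre CARD('a) (m - 1) (a * (norm u)\<^sup>2)" for u :: "complex ^ 'a"
  have Lm [measurable]: "L \<in> borel_measurable borel"
    unfolding L_def[abs_def] gen_laguerre_def by measurable
  define b where "b i = (-1) ^ i * real ((m - 1 + CARD('a)) choose (m - 1 - i)) / fact i * a ^ i" for i
  have Lb: "L u = (\<Sum>i\<le>m-1. b i * norm u ^ (2 * i))" for u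
    unfolding L_def gen_laguerre_def b_def by (intro sum.cong refl) (simp add: power_mult_distrib power_mult)
  have eq: "(L u)\<^sup>2 * exp (- a * (norm u)\<^sup>2)
      = (\<Sum>i\<le>m-1. \<Sum>j\<le>m-1. b i * b j * gauss_weight a (i + j) u)" for u
    unfolding power2_eq_square[of "L u"] unfolding Lb sum_product unfolding sum_distrib_right gauss_weight_def
    by (intro sum.cong refl) (simp add: power_add distrib_left)
  have "integrable lborel (\<lambda>u. (L u)\<^sup>2 * exp (- a * (norm u)\<^sup>2))"
    unfolding eq by (intro Bochner_Integration.integrable_sum integrable_mult_right integrable_gauss_weight assms)
  then have int: "integrable lborel (\<lambda>w. exp (a * (norm z)\<^sup>2) * ((L (- z + w))\<^sup>2 * exp (- a * (norm (- z + w))\<^sup>2)))"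
    by (intro integrable_mult_right, subst integrable_lborel_translate[of "\<lambda>u. (L u)\<^sup>2 * exp (- a * (norm u)\<^sup>2)"]) auto
  have "(cmod (explicit_kernel a m z w))\<^sup>2 * exp (- a * (norm w)\<^sup>2)
      = exp (a * (norm z)\<^sup>2) * ((L (- z + w))\<^sup>2 * exp (- a * (norm (- z + w))\<^sup>2))" for w
  proof -
    define s where "s = Re (\<Sum>r\<in>UNIV. w $ r * cnj (z $ r))"
    have n: "(norm (w - z))\<^sup>2 = (norm w)\<^sup>2 + (norm z)\<^sup>2 - 2 * s"
      unfolding s_def norm_vec_square sum.distrib[symmetric] Re_sum sum_distrib_left sum_subtractf[symmetric]
      by (intro sum.cong refl) (simp only: cmod_power2, simp add: power2_eq_square algebra_simps)
    have e: "2 * (a * s) + - a * (norm w)\<^sup>2 = a * (norm z)\<^sup>2 + - a * (norm (w - z))\<^sup>2"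
      unfolding n by (simp add: algebra_simps)
    have "(cmod (explicit_kernel a m z w))\<^sup>2 = exp (2 * (a * s)) * (L (w - z))\<^sup>2"
      by (simp add: explicit_kernel_def L_def norm_mult norm_exp_eq_Re s_def power_mult_distrib exp_double)
    then have "(cmod (explicit_kernel a m z w))\<^sup>2 * exp (- a * (norm w)\<^sup>2)
        = exp (2 * (a * s) + - a * (norm w)\<^sup>2) * (L (w - z))\<^sup>2"
      unfolding exp_add by simp
    also have "\<dots> = exp (a * (norm z)\<^sup>2) * ((L (- z + w))\<^sup>2 * exp (- a * (norm (- z + w))\<^sup>2))"
      unfolding e exp_add by simp
    finally show ?thesis .
  qed
  then show ?thesis using int by simp
qed

lemma explicit_kernel_in_Fock:
  "a > 0 \<Longrightarrow> m \<ge> 1 \<Longrightarrow> explicit_kernel a m z \<in> Fock a m"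
  unfolding Fock_def mem_Collect_eq m_analytic_iff_polyanalytic
  using polyanalytic_explicit_kernel explicit_kernel_square_integrable by blast

text \<open>Translation by z reduces the claim to \<open>laguerre_reproduces_origin\<close> for
  \<open>F u = f (z + u) * exp (- (of_real a * s u))\<close>.\<close>

lemma explicit_kernel_reproduces:
  fixes f :: "complex ^ 'n::finite \<Rightarrow> complex"
  assumes a: "a > 0" and m: "m \<ge> 1" and f: "f \<in> Fock a m"
  shows "f z = Fock_inner a f (explicit_kernel a m z)"
proof -
  have pa: "polyanalytic m f"
    and sq: "integrable lborel (\<lambda>z. (cmod (f z))\<^sup>2 * exp (- a * (norm z)\<^sup>2))"
    using f by (auto simp: Fock_def m_analytic_iff_polyanalytic)
  have cf: "continuous_on UNIV f"
    using smooth_continuous_on[OF polyanalytic_smooth[OF pa]] .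
  then have [measurable]: "f \<in> borel_measurable borel" by (rule borel_measurable_continuous_onI)
  define s where "s u = (\<Sum>r\<in>UNIV. u $ r * cnj (z $ r))" for u :: "complex ^ 'n"
  define F where "F u = f (z + u) * exp (- (of_real a * s u))" for u
  have cs: "continuous_on UNIV s" unfolding s_def by (intro continuous_intros)
  have cF: "continuous_on UNIV F"
    unfolding F_def by (intro continuous_intros continuous_on_compose2[OF cf] continuous_on_compose2[OF cs]) auto
  \<comment> \<open>The exponential in F compensates the shift of the Gaussian up to a constant, so
    F inherits square integrability from f.\<close>
  have ks: "(cmod (F u))\<^sup>2 * exp (- a * (norm u)\<^sup>2)
      = exp (a * (norm z)\<^sup>2) * ((cmod (f (z + u)))\<^sup>2 * exp (- a * (norm (z + u))\<^sup>2))" for u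
  proof -
    have n: "(norm (z + u))\<^sup>2 = (norm z)\<^sup>2 + (norm u)\<^sup>2 + 2 * Re (s u)"
      unfolding s_def norm_vec_square sum.distrib[symmetric] Re_sum sum_distrib_left
      by (intro sum.cong refl) (simp only: cmod_power2, simp add: power2_eq_square algebra_simps)
    have e: "2 * (- (a * Re (s u))) + - a * (norm u)\<^sup>2 = a * (norm z)\<^sup>2 + - a * (norm (z + u))\<^sup>2"
      unfolding n by (simp add: algebra_simps)
    have "(cmod (F u))\<^sup>2 = exp (2 * (- (a * Re (s u)))) * (cmod (f (z + u)))\<^sup>2"
      unfolding exp_double by (simp add: F_def norm_mult norm_exp_eq_Re power_mult_distrib)
    then have "(cmod (F u))\<^sup>2 * exp (- a * (norm u)\<^sup>2)
        = exp (2 * (- (a * Re (s u))) + - a * (norm u)\<^sup>2) * (cmod (f (z + u)))\<^sup>2"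
      unfolding exp_add by simp
    also have "\<dots> = exp (a * (norm z)\<^sup>2) * ((cmod (f (z + u)))\<^sup>2 * exp (- a * (norm (z + u))\<^sup>2))"
      unfolding e exp_add by simp
    finally show ?thesis .
  qed
  have sqF: "integrable lborel (\<lambda>u. (cmod (F u))\<^sup>2 * exp (- a * (norm u)\<^sup>2))"
    unfolding ks
    by (intro integrable_mult_right, subst integrable_lborel_translate[of "\<lambda>v. (cmod (f v))\<^sup>2 * exp (- a * (norm v)\<^sup>2)"])
      (use sq in auto)
  \<comment> \<open>Since s is complex linear, the exponential is entire in the line parameter l and
    serves as the factor E of \<open>polyanalytic_circle_average\<close>.\<close>
  have avg: "\<exists>c. c 0 = F 0 \<and> (\<forall>\<rho>>0. ((\<lambda>t. F ((of_real \<rho> * unit_circle t) *s u))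
         has_integral (\<Sum>j<m. c j * of_real (\<rho> ^ (2 * j)))) {0..1})" for u
  proof -
    have sl: "s (l *s u) = l * s u" for l
      by (simp add: s_def sum_distrib_left mult.assoc)
    have "(\<lambda>l. exp (- (of_real a * (l * s u)))) holomorphic_on UNIV"
      by (intro holomorphic_intros)
    from polyanalytic_circle_average[OF pa this, of z u] m
    show ?thesis by (simp add: F_def sl) (simp add: s_def)
  qed
  have "f (z + u) * cnj (explicit_kernel a m z (z + u)) * of_real (exp (- a * (norm (z + u))\<^sup>2))
      = F u * of_real (gen_laguerre CARD('n) (m - 1) (a * (norm u)\<^sup>2) * exp (- a * (norm u)\<^sup>2))" for u
  proof -
    have "exp (of_real a * (\<Sum>r\<in>UNIV. z $ r * cnj ((z + u) $ r))) * of_real (exp (- a * (norm (z + u))\<^sup>2))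
       = exp (- (of_real a * s u)) * of_real (exp (- a * (norm u)\<^sup>2))"
      using arg_cong[OF exponent_translate[of a z u], of exp]
      unfolding exp_add exp_of_real s_def by (simp only: mult.commute)
    then show ?thesis
      unfolding cnj_explicit_kernel unfolding explicit_kernel_def F_def
      by (simp add: mult_ac)
  qed
  then have "(LINT u|lborel. f (z + u) * cnj (explicit_kernel a m z (z + u)) * of_real (exp (- a * (norm (z + u))\<^sup>2)))
      = of_real ((pi / a) ^ CARD('n)) * F 0"
    using laguerre_reproduces_origin[OF cF a m sqF avg] by simp
  moreover have "(LINT u|lborel. f (z + u) * cnj (explicit_kernel a m z (z + u)) * of_real (exp (- a * (norm (z + u))\<^sup>2)))
      = (LINT w|lborel. f w * cnj (explicit_kernel a m z w) * of_real (exp (- a * (norm w)\<^sup>2)))"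
  proof (rule integral_lborel_translate[of "\<lambda>w. f w * cnj (explicit_kernel a m z w) * of_real (exp (- a * (norm w)\<^sup>2))"])
    have "continuous_on UNIV (explicit_kernel a m z)"
      by (rule smooth_continuous_on[OF polyanalytic_smooth[OF polyanalytic_explicit_kernel[OF m]]])
    then show "(\<lambda>w. f w * cnj (explicit_kernel a m z w) * of_real (exp (- a * (norm w)\<^sup>2))) \<in> borel_measurable borel"
      by (intro borel_measurable_continuous_onI continuous_intros cf)
  qed
  moreover have "F 0 = f z" by (simp add: F_def s_def)
  ultimately have "(LINT w|lborel. f w * cnj (explicit_kernel a m z w) * of_real (exp (- a * (norm w)\<^sup>2)))
      = of_real ((pi / a) ^ CARD('n)) * f z"
    by simp
  then show ?thesis
    unfolding Fock_inner_def using a by (simp only:) (simp add: power_divide)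
qed

text \<open>Testing the reproducing property of \<open>K\<close> on the explicit kernels determines \<open>K\<close>.\<close>
lemma Fock_kernel_eq_explicit_kernel:
  assumes "a > 0" "m \<ge> 1"
  shows "Fock_kernel a m z = explicit_kernel a m z"
  unfolding Fock_kernel_def
proof (rule the_equality)
  show "explicit_kernel a m z \<in> Fock a m \<and> (\<forall>f\<in>Fock a m. f z = Fock_inner a f (explicit_kernel a m z))"
    using assms explicit_kernel_in_Fock explicit_kernel_reproduces by blast
next
  fix K assume K: "K \<in> Fock a m \<and> (\<forall>f\<in>Fock a m. f z = Fock_inner a f K)"
  have inner_cnj: "Fock_inner a f g = cnj (Fock_inner a g f)" for f g :: "complex ^ 'a \<Rightarrow> complex"
  proof -
    have "cnj (LINT z|lborel. g z * cnj (f z) * of_real (exp (- a * (norm z)\<^sup>2)))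
        = (LINT z|lborel. f z * cnj (g z) * of_real (exp (- a * (norm z)\<^sup>2)))"
      unfolding Bochner_Integration.integral_cnj[symmetric] by (simp only: complex_cnj_mult complex_cnj_cnj complex_cnj_complex_of_real mult_ac)
    then show ?thesis
      unfolding Fock_inner_def complex_cnj_mult by simp
  qed
  show "K = explicit_kernel a m z"
  proof
    fix w
    have "K w = Fock_inner a K (explicit_kernel a m w)"
      using K assms explicit_kernel_reproduces by blast
    \<comment> \<open>The roles are exchanged: now K reproduces the value at z of the explicit
      kernel of w.\<close>
    also have "\<dots> = cnj (explicit_kernel a m w z)"
      using K assms explicit_kernel_in_Fock inner_cnj by metis
    finally show "K w = explicit_kernel a m z w" by (simp add: cnj_explicit_kernel)
  qed
qed

lemma explicit_kernel_eq_sum: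
  fixes z w :: "complex ^ 'n::finite"
  assumes "m \<ge> 1"
  shows "explicit_kernel a m z w =
           (\<Sum>k\<in>J m. \<Prod>r\<in>UNIV.
              exp (of_real a * (w $ r) * cnj (z $ r)) *
              of_real (laguerre_poly (k r) (a * (cmod (w $ r - z $ r))\<^sup>2)))"
proof -
  have "gen_laguerre CARD('n) (m - 1) (a * (norm (w - z))\<^sup>2)
      = (\<Sum>k\<in>J m. \<Prod>r\<in>UNIV. laguerre_poly (k r) (a * (cmod (w $ r - z $ r))\<^sup>2))"
    unfolding sum_J_prod_laguerre[OF assms] norm_vec_square by (simp add: sum_distrib_left)
  then show ?thesis
    by (simp add: explicit_kernel_def prod.distrib sum_distrib_left exp_sum mult.assoc)
qed

text \<open>By polarization the real part of x times the conjugate of y is (|x|^2 + |y|^2 - |x -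
  y|^2) / 2; the last term supplies the factor exp (- t / 2) of the Laguerre function.\<close>

lemma exp_laguerre_poly_eq_laguerre_fun:
  fixes x y :: complex
  shows "exp (of_real a * x * cnj y) * of_real (laguerre_poly j (a * (cmod (x - y))\<^sup>2))
    = exp (of_real (a / 2 * ((cmod x)\<^sup>2 + (cmod y)\<^sup>2)) + \<i> * of_real a * of_real (Im (x * cnj y)))
      * of_real (laguerre_fun j (a * (cmod (x - y))\<^sup>2))"
proof -
  have 1: "(cmod (x - y))\<^sup>2 = (cmod x)\<^sup>2 + (cmod y)\<^sup>2 - 2 * (Re x * Re y + Im x * Im y)"
    by (simp only: cmod_power2) (simp add: power2_eq_square algebra_simps)
  have "of_real a * x * cnj y = of_real (a / 2 * ((cmod x)\<^sup>2 + (cmod y)\<^sup>2))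
      + \<i> * of_real a * of_real (Im (x * cnj y)) + of_real (- (a * (cmod (x - y))\<^sup>2) / 2)"
    unfolding 1 by (simp add: complex_eq_iff algebra_simps add_divide_distrib diff_divide_distrib)
  then show ?thesis
    unfolding laguerre_fun_def of_real_mult exp_of_real[symmetric] by (simp only: exp_add mult.assoc)
qed

theorem corollary3p4:
  fixes \<alpha> :: real and m :: nat and z w :: "complex ^ 'n::finite"
  assumes "\<alpha> > 0" and "m \<ge> 1"
  shows "Fock_kernel \<alpha> m z w =
           (\<Sum>k\<in>J m. \<Prod>r\<in>UNIV.
              exp (of_real \<alpha> * (w $ r) * cnj (z $ r)) *
              of_real (laguerre_poly (k r) (\<alpha> * (cmod (w $ r - z $ r))\<^sup>2)))
       \<and> Fock_kernel \<alpha> m z w =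
           (\<Sum>k\<in>J m. \<Prod>r\<in>UNIV.
              exp (of_real (\<alpha> / 2 * ((cmod (w $ r))\<^sup>2 + (cmod (z $ r))\<^sup>2))
                   + \<i> * of_real \<alpha> * of_real (Im (w $ r * cnj (z $ r)))) *
              of_real (laguerre_fun (k r) (\<alpha> * (cmod (w $ r - z $ r))\<^sup>2)))"
  using explicit_kernel_eq_sum[OF assms(2), of \<alpha> z w]
  by (simp only: Fock_kernel_eq_explicit_kernel[OF assms] exp_laguerre_poly_eq_laguerre_fun)

end
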